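(* Let $G$ be the fundamental group of a finite graph of groups $(\mathcal{G},\Gamma)$. Suppose that there exist a group $A$ with (VRC) and a homomorphism $\varphi: G \to A$ such that (1) $\varphi$ is injective on every vertex group $G_v$, $v \in V\Gamma$; (2) the $\varphi$-image $\varphi(\alpha_e(G_e))$ of each edge group $G_e$, $e \in E\Gamma$, is closed in the profinite topology on $A$. Then $G$ has (VRC).
   Context: A subgroup $H$ of a group $G$ is a virtual retract of $G$ if there is a finite index subgroup $K$ of $G$ such that $H \subseteq K$ and there is a homomorphism $\rho: K \to H$ whose restriction to $H$ is the identity map. A group has property (VRC) if every cyclic subgroup is a virtual retract. The profinite topology on a group is the topology generated by the cosets of its finite index subgroups. Graphs are in the sense of Serre: a graph $\Gamma$ has a vertex set $V\Gamma$, an edge set $E\Gamma$, an inversion map $e \mapsto \overline{e}$ on $E\Gamma$ with $\overline{e} \ne e$ and $\overline{\overline{e}} = e$, and incidence maps $\alpha,\omega: E\Gamma \to V\Gamma$ with $\omega(\overline{e}) = \alpha(e)$. An orientation is a decomposition $E\Gamma = E\Gamma^+ \sqcup E\Gamma^-$ with $E\Gamma^- = \{\overline{e} \mid e \in E\Gamma^+\}$. A finite graph of groups $(\mathcal{G},\Gamma)$ consists of a non-empty finite connected graph $\Gamma$, vertex groups $G_v$ ($v \in V\Gamma$), edge groups $G_e$ ($e \in E\Gamma$) with $G_e = G_{\overline{e}}$, and monomorphisms $\alpha_e: G_e \to G_{\alpha(e)}$ ($e \in E\Gamma$); put $\omega_e := \alpha_{\overline{e}}: G_e \to G_{\omega(e)}$.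 Given a maximal tree $T$ in $\Gamma$ and an orientation, its fundamental group is the group generated by all $G_v$, $v \in V\Gamma$, and free letters $t_e$, $e \in E\Gamma^+$, subject to the relations of the vertex groups, $t_e\, \omega_e(a)\, t_e^{-1} = \alpha_e(a)$ for all $e \in E\Gamma^+$, $a \in G_e$, and $t_f = 1$ for all $f \in ET \cap E\Gamma^+$; up to isomorphism it does not depend on the choices. The vertex groups embed naturally in the fundamental group $G$ and are treated as subgroups of $G$; so $\alpha_e(G_e) \leqslant G_{\alpha(e)} \leqslant G$. *)

theory Defs
  imports
    "HOL-Algebra.Generated_Groups"
    "HOL-Analysis.Abstract_Topology"
    "Graph_Theory.Bidirected_Digraph"
    "Graph_Theory.Digraph_Component"
begin

definition finite_index :: "('a, 'm) monoid_scheme \<Rightarrow> 'a set \<Rightarrow> bool" where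
  "finite_index G K \<longleftrightarrow> subgroup K G \<and> finite (rcosets\<^bsub>G\<^esub> K)"

definition virtual_retract :: "('a, 'm) monoid_scheme \<Rightarrow> 'a set \<Rightarrow> bool" where
  "virtual_retract G H \<longleftrightarrow> subgroup H G \<and>
     (\<exists>K. finite_index G K \<and> H \<subseteq> K \<and>
       (\<exists>\<rho> \<in> hom (G\<lparr>carrier := K\<rparr>) (G\<lparr>carrier := H\<rparr>). \<forall>h\<in>H. \<rho> h = h))"

definition VRC :: "('a, 'm) monoid_scheme \<Rightarrow> bool" where
  "VRC G \<longleftrightarrow> group G \<and> (\<forall>g\<in>carrier G. virtual_retract G (generate G {g}))"

definition profinite_topology :: "('a, 'm) monoid_scheme \<Rightarrow> 'a topology" where
  "profinite_topology G = topology_generated_by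
     ({K #>\<^bsub>G\<^esub> x | K x. finite_index G K \<and> x \<in> carrier G} \<union>
      {x <#\<^bsub>G\<^esub> K | K x. finite_index G K \<and> x \<in> carrier G})"

text \<open>A letter \<open>(x, True)\<close> stands for the generator \<open>x\<close> and \<open>(x, False)\<close> for its formal
  inverse. A relation \<open>u = v\<close> is given as the pair \<open>(u, v)\<close> of words. The presented group consists
  of the words modulo the congruence generated by free cancellation and the relations.\<close>

type_synonym 'x word = "('x \<times> bool) list"

abbreviation words :: "'x set \<Rightarrow> 'x word set" where
  "words S \<equiv> lists (S \<times> UNIV)"

inductive word_eq :: "'x set \<Rightarrow> ('x word \<times> 'x word) set \<Rightarrow> 'x word \<Rightarrow> 'x word \<Rightarrow> bool"
  for S :: "'x set" and R :: "('x word \<times> 'x word) set" where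
  refl: "u \<in> words S \<Longrightarrow> word_eq S R u u"
| sym: "word_eq S R u v \<Longrightarrow> word_eq S R v u"
| trans: "word_eq S R u v \<Longrightarrow> word_eq S R v w \<Longrightarrow> word_eq S R u w"
| cong: "word_eq S R u v \<Longrightarrow> word_eq S R u' v' \<Longrightarrow> word_eq S R (u @ u') (v @ v')"
| cancel: "x \<in> S \<Longrightarrow> word_eq S R [(x, b), (x, \<not> b)] []"
| rel: "(u, v) \<in> R \<Longrightarrow> u \<in> words S \<Longrightarrow> v \<in> words S \<Longrightarrow> word_eq S R u v"

definition word_class :: "'x set \<Rightarrow> ('x word \<times> 'x word) set \<Rightarrow> 'x word \<Rightarrow> 'x word set" where
  "word_class S R u = {v. word_eq S R u v}"

definition presented_group ::
    "'x set \<Rightarrow> ('x word \<times> 'x word) set \<Rightarrow> 'x word set monoid" where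
  "presented_group S R =
     \<lparr>carrier = word_class S R ` words S,
      monoid.mult = (\<lambda>X Y. \<Union>u\<in>X. \<Union>v\<in>Y. word_class S R (u @ v)),
      one = word_class S R []\<rparr>"

lemma word_eq_words: "word_eq S R u v \<Longrightarrow> u \<in> words S \<and> v \<in> words S"
  by (induction rule: word_eq.induct) auto

lemma word_class_eq: "word_eq S R u v \<Longrightarrow> word_class S R u = word_class S R v"
  unfolding word_class_def by (blast intro: word_eq.sym word_eq.trans)

lemma word_class_mult:
  assumes "u \<in> words S" "v \<in> words S"
  shows "word_class S R u \<otimes>\<^bsub>presented_group S R\<^esub> word_class S R v = word_class S R (u @ v)"
proof -
  have "word_class S R (u' @ v') = word_class S R (u @ v)"
    if "u' \<in> word_class S R u" "v' \<in> word_class S R v" for u' v'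
    using that by (intro word_class_eq word_eq.cong) (auto simp: word_class_def dest: word_eq.sym)
  moreover have "u \<in> word_class S R u" "v \<in> word_class S R v"
    using assms by (auto simp: word_class_def intro: word_eq.refl)
  ultimately have "(\<Union>u'\<in>word_class S R u. \<Union>v'\<in>word_class S R v. word_class S R (u' @ v')) =
      word_class S R (u @ v)"
    by blast
  then show ?thesis
    by (simp add: presented_group_def)
qed

lemma word_eq_inverse:
  "u \<in> words S \<Longrightarrow> word_eq S R (map (\<lambda>(x, b). (x, \<not> b)) (rev u) @ u) []"
proof (induction u)
  case Nil
  then show ?case by (simp add: word_eq.refl)
next
  case (Cons a u)
  obtain x b where a: "a = (x, b)" by (cases a)
  let ?i = "map (\<lambda>(x, b). (x, \<not> b)) (rev u)"
  have x: "x \<in> S" and u: "u \<in> words S" using Cons.prems a by auto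
  have i: "?i \<in> words S" using u by (auto simp: in_lists_conv_set)
  have "word_eq S R [(x, \<not> b), (x, b)] []"
    using word_eq.cancel[OF x, of R "\<not> b"] by simp
  then have "word_eq S R (?i @ [(x, \<not> b), (x, b)] @ u) (?i @ [] @ u)"
    by (intro word_eq.cong word_eq.refl i u)
  from word_eq.trans[OF this] Cons.IH[OF u] show ?case
    by (simp add: a)
qed

lemma group_presented_group: "group (presented_group S R)"
proof (rule groupI)
  let ?G = "presented_group S R"
  have C: "carrier ?G = word_class S R ` words S" and O: "\<one>\<^bsub>?G\<^esub> = word_class S R []"
    by (simp_all add: presented_group_def)
  show "\<And>x y. \<lbrakk>x \<in> carrier ?G; y \<in> carrier ?G\<rbrakk> \<Longrightarrow> x \<otimes>\<^bsub>?G\<^esub> y \<in> carrier ?G"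
    unfolding C by (elim imageE) (simp add: word_class_mult imageI del: in_lists_conv_set)
  show "\<one>\<^bsub>?G\<^esub> \<in> carrier ?G"
    unfolding C O by simp
  show "\<And>x. x \<in> carrier ?G \<Longrightarrow> \<one>\<^bsub>?G\<^esub> \<otimes>\<^bsub>?G\<^esub> x = x"
    unfolding C O by (elim imageE) (simp add: word_class_mult del: in_lists_conv_set)
  show "\<And>x y z. \<lbrakk>x \<in> carrier ?G; y \<in> carrier ?G; z \<in> carrier ?G\<rbrakk>
      \<Longrightarrow> x \<otimes>\<^bsub>?G\<^esub> y \<otimes>\<^bsub>?G\<^esub> z = x \<otimes>\<^bsub>?G\<^esub> (y \<otimes>\<^bsub>?G\<^esub> z)"
    unfolding C by (elim imageE) (simp add: word_class_mult del: in_lists_conv_set)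
  show "\<exists>y\<in>carrier ?G. y \<otimes>\<^bsub>?G\<^esub> x = \<one>\<^bsub>?G\<^esub>" if x: "x \<in> carrier ?G" for x
  proof -
    obtain u where u: "u \<in> words S" "x = word_class S R u" using x unfolding C by auto
    let ?i = "map (\<lambda>(x, b). (x, \<not> b)) (rev u)"
    have i: "?i \<in> words S" using u by (auto simp: in_lists_conv_set)
    then have "word_class S R ?i \<otimes>\<^bsub>?G\<^esub> x = \<one>\<^bsub>?G\<^esub>"
      unfolding O using u word_class_eq[OF word_eq_inverse[OF u(1)]]
      by (simp add: word_class_mult del: in_lists_conv_set)
    with i show ?thesis unfolding C by blast
  qed
qed

text \<open>A graph in the sense of Serre is a \<^locale>\<open>bidirected_digraph\<close>, with \<open>\<alpha> = tail\<close>,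
  \<open>\<omega> = head\<close> and inversion \<open>arev\<close>; that locale normalizes \<open>arev\<close> to be the identity off the
  edge set. \<^const>\<open>Digraph_Component.connected\<close> includes non-emptiness. The library's
  \<open>Digraph_Component.tree\<close> is not suitable: it would count the backtracking path
  \<open>e, arev e\<close> as a cycle.\<close>

definition serre_tree :: "('v, 'e) pre_digraph \<Rightarrow> ('e \<Rightarrow> 'e) \<Rightarrow> bool" where
  "serre_tree T arev \<longleftrightarrow> Digraph_Component.connected T \<and>
     \<not> (\<exists>p. pre_digraph.cycle T p \<and> successively (\<lambda>e f. f \<noteq> arev e) p)"

definition maximal_tree ::
    "('v, 'e) pre_digraph \<Rightarrow> ('v, 'e) pre_digraph \<Rightarrow> ('e \<Rightarrow> 'e) \<Rightarrow> bool" where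
  "maximal_tree T \<Gamma> arev \<longleftrightarrow>
     pre_digraph.max_subgraph \<Gamma> (\<lambda>T. arev ` arcs T \<subseteq> arcs T \<and> serre_tree T arev) T"

definition orientation :: "'e set \<Rightarrow> ('v, 'e) pre_digraph \<Rightarrow> ('e \<Rightarrow> 'e) \<Rightarrow> bool" where
  "orientation P \<Gamma> arev \<longleftrightarrow> arcs \<Gamma> = P \<union> arev ` P \<and> P \<inter> arev ` P = {}"

record ('v, 'e, 'g, 'h) graph_of_groups =
  base :: "('v, 'e) pre_digraph"
  inversion :: "'e \<Rightarrow> 'e"
  vgroup :: "'v \<Rightarrow> 'g monoid"
  egroup :: "'e \<Rightarrow> 'h monoid"
  alpha :: "'e \<Rightarrow> 'h \<Rightarrow> 'g"

definition omega :: "('v, 'e, 'g, 'h) graph_of_groups \<Rightarrow> 'e \<Rightarrow> 'h \<Rightarrow> 'g" where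
  "omega \<G> e = alpha \<G> (inversion \<G> e)"

locale finite_graph_of_groups =
  fin_digraph "base \<G>" + bidirected_digraph "base \<G>" "inversion \<G>"
  for \<G> :: "('v, 'e, 'g, 'h) graph_of_groups" +
  assumes connected_base: "Digraph_Component.connected (base \<G>)"
    and vgroup: "v \<in> verts (base \<G>) \<Longrightarrow> group (vgroup \<G> v)"
    and egroup: "e \<in> arcs (base \<G>) \<Longrightarrow> group (egroup \<G> e)"
    and egroup_inversion: "e \<in> arcs (base \<G>) \<Longrightarrow> egroup \<G> (inversion \<G> e) = egroup \<G> e"
    and alpha_mon: "e \<in> arcs (base \<G>) \<Longrightarrow>
      alpha \<G> e \<in> mon (egroup \<G> e) (vgroup \<G> (tail (base \<G>) e))"

datatype ('v, 'e, 'g) generator = Vertex_Elem 'v 'g | Stable_Letter 'e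

definition fg_generators ::
    "('v, 'e, 'g, 'h) graph_of_groups \<Rightarrow> 'e set \<Rightarrow> ('v, 'e, 'g) generator set" where
  "fg_generators \<G> P =
     {Vertex_Elem v g | v g. v \<in> verts (base \<G>) \<and> g \<in> carrier (vgroup \<G> v)} \<union>
     {Stable_Letter e | e. e \<in> P}"

definition fg_relations ::
    "('v, 'e, 'g, 'h) graph_of_groups \<Rightarrow> ('v, 'e) pre_digraph \<Rightarrow> 'e set \<Rightarrow>
     (('v, 'e, 'g) generator word \<times> ('v, 'e, 'g) generator word) set" where
  "fg_relations \<G> T P =
     {([(Vertex_Elem v x, True), (Vertex_Elem v y, True)],
       [(Vertex_Elem v (x \<otimes>\<^bsub>vgroup \<G> v\<^esub> y), True)]) | v x y.
         v \<in> verts (base \<G>) \<and> x \<in> carrier (vgroup \<G> v) \<and> y \<in> carrier (vgroup \<G> v)} \<union>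
     {([(Stable_Letter e, True), (Vertex_Elem (head (base \<G>) e) (omega \<G> e a), True),
        (Stable_Letter e, False)],
       [(Vertex_Elem (tail (base \<G>) e) (alpha \<G> e a), True)]) | e a.
         e \<in> P \<and> a \<in> carrier (egroup \<G> e)} \<union>
     {([(Stable_Letter f, True)], []) | f. f \<in> arcs T \<inter> P}"

definition fundamental_group ::
    "('v, 'e, 'g, 'h) graph_of_groups \<Rightarrow> ('v, 'e) pre_digraph \<Rightarrow> 'e set \<Rightarrow>
     ('v, 'e, 'g) generator word set monoid" where
  "fundamental_group \<G> T P = presented_group (fg_generators \<G> P) (fg_relations \<G> T P)"

definition vertex_embedding ::
    "('v, 'e, 'g, 'h) graph_of_groups \<Rightarrow> ('v, 'e) pre_digraph \<Rightarrow> 'e set \<Rightarrow>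
     'v \<Rightarrow> 'g \<Rightarrow> ('v, 'e, 'g) generator word set" where
  "vertex_embedding \<G> T P v g =
     word_class (fg_generators \<G> P) (fg_relations \<G> T P) [(Vertex_Elem v g, True)]"

text \<open>The vertex group \<open>G\<^sub>v\<close> and the subgroup \<open>\<alpha>\<^sub>e(G\<^sub>e)\<close> of \<open>G\<^bsub>\<alpha>(e)\<^esub>\<close>, regarded as
  subgroups of the fundamental group.\<close>

definition vertex_subgroup ::
    "('v, 'e, 'g, 'h) graph_of_groups \<Rightarrow> ('v, 'e) pre_digraph \<Rightarrow> 'e set \<Rightarrow>
     'v \<Rightarrow> ('v, 'e, 'g) generator word set set" where
  "vertex_subgroup \<G> T P v = vertex_embedding \<G> T P v ` carrier (vgroup \<G> v)"

definition edge_subgroup ::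
    "('v, 'e, 'g, 'h) graph_of_groups \<Rightarrow> ('v, 'e) pre_digraph \<Rightarrow> 'e set \<Rightarrow>
     'e \<Rightarrow> ('v, 'e, 'g) generator word set set" where
  "edge_subgroup \<G> T P e =
     vertex_embedding \<G> T P (tail (base \<G>) e) ` alpha \<G> e ` carrier (egroup \<G> e)"

end

(* Let g be an element of the fundamental group G. If \<phi> is injective on the cyclic group of g, then
   a virtual retraction of A pulls back to G. Otherwise some power h of g is a nontrivial element of
   the kernel of \<phi>. It is represented by a closed path x1 e1 x2 e2 ... without backtracking, where
   backtracking means that e_{i+1} is the inverse of e_i and x_{i+1} lies in the edge group. Since
   \<phi> is injective on the vertex groups and the images of the edge groups are closed, the path remains
   without backtracking in a finite quotient Q of A.

   Twisting the homomorphism from G to Q by free letters s_e, where s_e commutes with the image E_e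
   of the edge group, gives a homomorphism from G to the semidirect product of Q with the free group
   on the letters (e, q E_e), and the image of h in the free group is exactly the reduced word read
   off the path. In particular normal forms in G are not needed. As in M. Hall's theorem, the
   free group acts on finitely many copies of the integers, commuting with a translation, in
   such a way that this word acts on some point as the translation. Inducing this action to G and
   summing the displacements over an orbit of g gives a homomorphism to the integers with value 1
   at g, defined on a subgroup of finite index. *)

theory Submission
  imports Defs
begin

section \<open>Subgroups of finite index and virtual retracts\<close>

text \<open>A finite quotient kills a power of every element, so by itself it cannot detect infinite
  order. What survives in it is the shape of the path, and the twist by the letters s_e converts the
  lack of backtracking into a word that a free group can detect. A shortest path is enough: that it
  represents a nontrivial element need not be known beforehand, since its translation shows it.
  Neither the free group nor the semidirect product is built. Words act directly on two copies of
  the integers, and the induced action lives on the product of \<open>Q\<close> with these copies;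
  the target of the homomorphism is the group of permutations of this set that commute with the
  translations. The letter s_e acts over a point q through the coset q^-1 E_e. This coset does not
  change when q is multiplied on the left by E_e, which is exactly the commutation that the edge
  relations demand. The displacement is known only for a power of g and at one point, while a
  retraction onto the group of g needs the value 1 at g itself; summing over the orbit bridges this
  gap.\<close>

text \<open>With a representative chosen in each right coset, \<open>c\<close> becomes injective on
  cosets, so its finitely many values bound the index. Every finite index below comes from a
  suitable \<open>c\<close>.\<close>

lemma (in group) finite_index_if_separated:
  assumes K: "subgroup K G" and fin: "finite C" and c: "\<And>x. x \<in> carrier G \<Longrightarrow> c x \<in> C"
    and sep: "\<And>x y. \<lbrakk>x \<in> carrier G; y \<in> carrier G; c x = c y\<rbrakk> \<Longrightarrow> x \<otimes> inv y \<in> K"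
  shows "finite_index G K"
proof -
  define r where "r X = (SOME x. x \<in> carrier G \<and> K #> x = X)" for X
  have r: "r X \<in> carrier G \<and> K #> r X = X" if "X \<in> rcosets K" for X
    unfolding r_def by (rule someI_ex) (use that in \<open>auto simp: RCOSETS_def\<close>)
  have "inj_on (c \<circ> r) (rcosets K)"
  proof (rule inj_onI)
    fix X Y assume XY: "X \<in> rcosets K" "Y \<in> rcosets K" "(c \<circ> r) X = (c \<circ> r) Y"
    then have "r X \<otimes> inv r Y \<in> K" using r[of X] r[of Y] sep by simp
    then have "r X \<in> K #> r Y"
      using r[OF XY(1)] r[OF XY(2)] subgroup.rcos_module_rev[OF K is_group] by blast
    then have "K #> r Y = K #> r X"
      using r[OF XY(2)] K by (intro repr_independence) auto
    then show "X = Y" using r XY by metis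
  qed
  moreover have "(c \<circ> r) ` (rcosets K) \<subseteq> C" using r c by auto
  ultimately have "finite (rcosets K)" using fin by (meson finite_subset finite_imageD)
  with K show ?thesis by (simp add: finite_index_def)
qed

lemma (in group) r_coset_eq_iff:
  assumes "subgroup K G" "x \<in> carrier G" "y \<in> carrier G"
  shows "K #> x = K #> y \<longleftrightarrow> x \<otimes> inv y \<in> K"
  using assms subgroup.rcos_module[OF assms(1) is_group, of y x]
    repr_independence[of x K y] repr_independenceD[of K x y] rcos_self[of x K]
  by blast

lemma (in group) l_coset_eq_iff:
  assumes K: "subgroup K G" and x: "x \<in> carrier G" and y: "y \<in> carrier G"
  shows "x <#\<^bsub>G\<^esub> K = y <#\<^bsub>G\<^esub> K \<longleftrightarrow> inv x \<otimes> y \<in> K"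
proof
  assume eq: "x <#\<^bsub>G\<^esub> K = y <#\<^bsub>G\<^esub> K"
  have "y \<in> y <#\<^bsub>G\<^esub> K" using subgroup.one_closed[OF K] y by (force simp: l_coset_def)
  with eq obtain k where "k \<in> K" "y = x \<otimes> k" unfolding l_coset_def by auto
  then show "inv x \<otimes> y \<in> K"
    using x subgroup.mem_carrier[OF K] by (simp flip: m_assoc)
next
  assume k: "inv x \<otimes> y \<in> K"
  then have "(inv x \<otimes> y) <#\<^bsub>G\<^esub> K = K" using K by (intro coset_join3) (simp_all add: x y)
  then have "x <#\<^bsub>G\<^esub> K = x <#\<^bsub>G\<^esub> ((inv x \<otimes> y) <#\<^bsub>G\<^esub> K)" by simp
  also have "\<dots> = y <#\<^bsub>G\<^esub> K"
    using x y subgroup.subset[OF K] by (simp add: lcos_m_assoc) (simp flip: m_assoc)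
  finally show "x <#\<^bsub>G\<^esub> K = y <#\<^bsub>G\<^esub> K" .
qed

text \<open>The tuple of cosets of x is the separating invariant. Intersecting with
  \<open>carrier G\<close> gives the right value when \<open>I\<close> is empty.\<close>

lemma (in group) finite_index_INT:
  assumes "finite I" "\<And>i. i \<in> I \<Longrightarrow> finite_index G (K i)"
  shows "finite_index G (carrier G \<inter> (\<Inter>i\<in>I. K i))"
proof (rule finite_index_if_separated[where C = "\<Pi>\<^sub>E i\<in>I. rcosets (K i)" and c = "\<lambda>x. \<lambda>i\<in>I. K i #> x"])
  have K: "subgroup (K i) G" if "i \<in> I" for i using assms(2)[OF that] by (simp add: finite_index_def)
  show "subgroup (carrier G \<inter> (\<Inter>i\<in>I. K i)) G"
    by (rule subgroupI) (use K in \<open>auto simp: subgroup.one_closed subgroup.m_closed subgroup.m_inv_closed\<close>)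
  show "finite (\<Pi>\<^sub>E i\<in>I. rcosets (K i))"
    using assms by (intro finite_PiE) (auto simp: finite_index_def)
  show "(\<lambda>i\<in>I. K i #> x) \<in> (\<Pi>\<^sub>E i\<in>I. rcosets (K i))" if "x \<in> carrier G" for x
    using that K by (auto intro!: rcosetsI dest: subgroup.subset)
  show "x \<otimes> inv y \<in> carrier G \<inter> (\<Inter>i\<in>I. K i)"
    if xy: "x \<in> carrier G" "y \<in> carrier G" "(\<lambda>i\<in>I. K i #> x) = (\<lambda>i\<in>I. K i #> y)" for x y
  proof -
    have "K i #> x = K i #> y" if "i \<in> I" for i using fun_cong[OF xy(3), of i] that by simp
    then show ?thesis using xy K by (auto simp: r_coset_eq_iff)
  qed
qed

lemma (in group) finite_index_normal_INT:
  assumes "finite I" "\<And>i. i \<in> I \<Longrightarrow> finite_index G (N i)" "\<And>i. i \<in> I \<Longrightarrow> N i \<lhd> G"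
  shows "carrier G \<inter> (\<Inter>i\<in>I. N i) \<lhd> G"
  using finite_index_INT[of I N] assms unfolding normal_inv_iff by (auto simp: finite_index_def)

text \<open>The normal core is the kernel of the action on the cosets.\<close>

lemma (in group) finite_index_core:
  assumes fi: "finite_index G K"
  obtains N where "finite_index G N" "N \<lhd> G" "N \<subseteq> K"
proof -
  have K: "subgroup K G" and fin: "finite (rcosets K)" using fi by (simp_all add: finite_index_def)
  define N where "N = {a \<in> carrier G. \<forall>X \<in> rcosets K. X #> a = X}"
  have sub: "X \<subseteq> carrier G" if "X \<in> rcosets K" for X
    using that subgroup.rcosets_carrier[OF K is_group] by blast
  have act: "X #> a \<in> rcosets K" if "X \<in> rcosets K" "a \<in> carrier G" for X a
    using that subgroup.subset[OF K]
    by (auto simp: RCOSETS_def coset_mult_assoc intro!: bexI[of _ "_ \<otimes> a"])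
  have inv_fix: "X #> inv a = X" if "a \<in> carrier G" "X \<subseteq> carrier G" "X #> a = X" for X a
    using that coset_mult_assoc[of X a "inv a"] by simp
  have N: "subgroup N G"
  proof (rule subgroupI)
    show "N \<noteq> {}" using sub unfolding N_def by auto
    show "inv a \<in> N" if "a \<in> N" for a using that sub inv_fix unfolding N_def by auto
    show "a \<otimes> b \<in> N" if "a \<in> N" "b \<in> N" for a b
      using that sub unfolding N_def by (auto simp flip: coset_mult_assoc)
  qed (auto simp: N_def)
  have fiN: "finite_index G N"
  proof (rule finite_index_if_separated[OF N,
        where C = "\<Pi>\<^sub>E X\<in>rcosets K. rcosets K" and c = "\<lambda>a. \<lambda>X\<in>rcosets K. X #> a"])
    show "finite (\<Pi>\<^sub>E X\<in>rcosets K. rcosets K)" using fin by (intro finite_PiE)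
    show "(\<lambda>X\<in>rcosets K. X #> a) \<in> (\<Pi>\<^sub>E X\<in>rcosets K. rcosets K)" if "a \<in> carrier G" for a
      using act that by auto
    show "a \<otimes> inv b \<in> N"
      if ab: "a \<in> carrier G" "b \<in> carrier G"
        and eq: "(\<lambda>X\<in>rcosets K. X #> a) = (\<lambda>X\<in>rcosets K. X #> b)" for a b
    proof -
      have "X #> (a \<otimes> inv b) = X" if X: "X \<in> rcosets K" for X
      proof -
        have "X #> a = X #> b" using fun_cong[OF eq, of X] X by simp
        then have "X #> (a \<otimes> inv b) = (X #> b) #> inv b"
          using ab sub[OF X] by (simp flip: coset_mult_assoc)
        then show ?thesis using ab sub[OF X] by (simp add: coset_mult_assoc)
      qed
      then show ?thesis using ab by (simp add: N_def)
    qed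
  qed
  have "N \<lhd> G"
  proof (subst normal_inv_iff, intro conjI N ballI)
    fix x h assume x: "x \<in> carrier G" and h: "h \<in> N"
    then have hG: "h \<in> carrier G" by (simp add: N_def)
    have "X #> (x \<otimes> h \<otimes> inv x) = X" if X: "X \<in> rcosets K" for X
    proof -
      have "X #> (x \<otimes> h \<otimes> inv x) = ((X #> x) #> h) #> inv x"
        using x hG sub[OF X] by (simp add: coset_mult_assoc r_coset_subset_G)
      also have "(X #> x) #> h = X #> x" using act[OF X x] h by (simp add: N_def)
      finally show ?thesis using x sub[OF X] by (simp add: coset_mult_assoc)
    qed
    then show "x \<otimes> h \<otimes> inv x \<in> N" using x hG by (simp add: N_def)
  qed
  moreover have "N \<subseteq> K"
  proof
    fix a assume a: "a \<in> N"
    have "K \<in> rcosets K" using rcosetsI[OF subgroup.subset[OF K] one_closed] subgroup.subset[OF K] by simp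
    then have "K #> a = K" using a by (simp add: N_def)
    then show "a \<in> K" using a K by (intro coset_join1[of K a]) (auto simp: N_def)
  qed
  ultimately show thesis using that fiN by blast
qed

section \<open>Separating a point from a closed set in the profinite topology\<close>

text \<open>The complement of \<open>E\<close> is an open set around \<open>a\<close>. Containing a
  translate \<open>N a\<close> of a normal subgroup of finite index is a property that passes
  through finite intersections and unions, so only the generating cosets have to be examined; there
  the normal core of \<open>K\<close> serves.\<close>

lemma closedin_profinite_separated:
  assumes A: "group A" and closed: "closedin (profinite_topology A) E"
    and a: "a \<in> carrier A" "a \<notin> E"
  obtains N where "finite_index A N" "N \<lhd> A" "\<And>n. n \<in> N \<Longrightarrow> n \<otimes>\<^bsub>A\<^esub> a \<notin> E"
proof -
  interpret A: group A by (rule A)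
  let ?S = "{K #>\<^bsub>A\<^esub> x | K x. finite_index A K \<and> x \<in> carrier A} \<union>
    {x <#\<^bsub>A\<^esub> K | K x. finite_index A K \<and> x \<in> carrier A}"
  let ?nbhd = "\<lambda>U N. finite_index A N \<and> N \<lhd> A \<and> (\<forall>n\<in>N. n \<otimes>\<^bsub>A\<^esub> a \<in> U)"
  have top: "topspace (profinite_topology A) = \<Union>?S"
    unfolding profinite_topology_def by (rule topology_generated_by_topspace)
  have full: "finite_index A (carrier A)"
  proof (rule A.finite_index_if_separated[where C = "{()}" and c = "\<lambda>_. ()"])
    show "subgroup (carrier A) A" by (rule A.subgroup_self)
  qed auto
  \<comment> \<open>The topspace is only known as the union of the generating sets, so
    \<open>a\<close> has to be exhibited in one of them.\<close>
  have "a \<in> carrier A #>\<^bsub>A\<^esub> \<one>\<^bsub>A\<^esub>" using a(1) by simp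
  moreover have "carrier A #>\<^bsub>A\<^esub> \<one>\<^bsub>A\<^esub> \<in> ?S" using full A.one_closed by blast
  ultimately have "a \<in> \<Union>?S" by (rule UnionI[rotated])
  then have a_in: "a \<in> \<Union>?S - E" using a(2) by simp
  have "generate_topology_on ?S (\<Union>?S - E)"
    using closed unfolding closedin_def top openin_topology_generated_by_iff profinite_topology_def
    by simp
  then have "\<exists>N. ?nbhd (\<Union>?S - E) N" using a_in
  proof (induction rule: generate_topology_on.induct)
    case (Int U V)
    then obtain M N where "?nbhd U M" "?nbhd V N" by blast
    moreover have "finite_index A (carrier A \<inter> (\<Inter>X\<in>{M, N}. X))" "carrier A \<inter> (\<Inter>X\<in>{M, N}. X) \<lhd> A"
      using calculation
      by (intro A.finite_index_INT A.finite_index_normal_INT; auto)+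
    ultimately show ?case by (intro exI[of _ "carrier A \<inter> (\<Inter>X\<in>{M, N}. X)"]) auto
  next
    case (UN \<K>)
    then show ?case by blast
  next
    case (Basis U)
    then consider
      (right) K x where "finite_index A K" "x \<in> carrier A" "U = K #>\<^bsub>A\<^esub> x"
    | (left) K x where "finite_index A K" "x \<in> carrier A" "U = x <#\<^bsub>A\<^esub> K" by blast
    then show ?case
    proof cases
      case right
      then have K: "subgroup K A" by (simp add: finite_index_def)
      obtain N where N: "finite_index A N" "N \<lhd> A" "N \<subseteq> K" using A.finite_index_core[OF right(1)] .
      have "n \<otimes>\<^bsub>A\<^esub> a \<in> U" if "n \<in> N" for n
      proof -
        have "U = K #>\<^bsub>A\<^esub> a" using A.repr_independence[of a K x] Basis.prems right K by simp
        then show ?thesis using that N(3) by (auto simp: r_coset_def)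
      qed
      then show ?thesis using N by blast
    next
      \<comment> \<open>Here normality matters: n a = a (a^-1 n a) turns the left translation by n
        into a right translation by an element of \<open>K\<close>.\<close>
      case left
      then have K: "subgroup K A" by (simp add: finite_index_def)
      obtain N where N: "finite_index A N" "N \<lhd> A" "N \<subseteq> K" using A.finite_index_core[OF left(1)] .
      have "n \<otimes>\<^bsub>A\<^esub> a \<in> U" if n: "n \<in> N" for n
      proof -
        have nA: "n \<in> carrier A" using subgroup.mem_carrier[OF normal_imp_subgroup[OF N(2)] n] .
        obtain k where k: "k \<in> K" "a = x \<otimes>\<^bsub>A\<^esub> k" using Basis.prems left by (auto simp: l_coset_def)
        have kA: "k \<in> carrier A" using subgroup.mem_carrier[OF K k(1)] .
        have "inv\<^bsub>A\<^esub> a \<otimes>\<^bsub>A\<^esub> n \<otimes>\<^bsub>A\<^esub> a \<in> K" using normal.inv_op_closed1[OF N(2) a(1) n] N(3) by blast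
        then have "k \<otimes>\<^bsub>A\<^esub> (inv\<^bsub>A\<^esub> a \<otimes>\<^bsub>A\<^esub> n \<otimes>\<^bsub>A\<^esub> a) \<in> K" using k(1) K by (simp add: subgroup.m_closed)
        moreover have "n \<otimes>\<^bsub>A\<^esub> a = x \<otimes>\<^bsub>A\<^esub> (k \<otimes>\<^bsub>A\<^esub> (inv\<^bsub>A\<^esub> a \<otimes>\<^bsub>A\<^esub> n \<otimes>\<^bsub>A\<^esub> a))"
        proof -
          have "x \<otimes>\<^bsub>A\<^esub> (k \<otimes>\<^bsub>A\<^esub> (inv\<^bsub>A\<^esub> a \<otimes>\<^bsub>A\<^esub> n \<otimes>\<^bsub>A\<^esub> a)) = a \<otimes>\<^bsub>A\<^esub> (inv\<^bsub>A\<^esub> a \<otimes>\<^bsub>A\<^esub> (n \<otimes>\<^bsub>A\<^esub> a))"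
            using left(2) kA nA a(1) by (simp add: k(2) A.m_assoc)
          then show ?thesis using nA a(1) by (simp flip: A.m_assoc)
        qed
        ultimately show ?thesis unfolding left(3) l_coset_def by blast
      qed
      then show ?thesis using N by blast
    qed
  qed simp
  then show thesis using that by blast
qed

section \<open>Criteria for a cyclic subgroup to be a virtual retract\<close>

text \<open>Since \<open>h\<close> carries the group of \<open>g\<close> isomorphically onto that of
  \<open>h g\<close>, the map \<open>h\<close>, the retraction \<open>r\<close> and the inverse
  \<open>j\<close> of this isomorphism compose to a retraction on the preimage of
  \<open>K\<close>.\<close>

lemma (in group_hom) virtual_retract_pullback:
  assumes g: "g \<in> carrier G" and inj: "inj_on h (generate G {g})"
    and vr: "virtual_retract H (generate H {h g})"
  shows "virtual_retract G (generate G {g})"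
proof -
  let ?C = "generate G {g}" and ?D = "generate H {h g}"
  obtain K r where K: "finite_index H K" "?D \<subseteq> K" and r: "r \<in> hom (H\<lparr>carrier := K\<rparr>) (H\<lparr>carrier := ?D\<rparr>)"
    and r_id: "\<And>d. d \<in> ?D \<Longrightarrow> r d = d"
    using vr unfolding virtual_retract_def by blast
  have img: "h ` ?C = ?D" using generate_img[of "{g}"] g by simp
  have C: "subgroup ?C G" using g by (intro G.generate_is_subgroup) simp
  have KH: "subgroup K H" using K by (simp add: finite_index_def)
  define K' where "K' = {x \<in> carrier G. h x \<in> K}"
  have K': "subgroup K' G"
    by (rule G.subgroupI)
      (auto simp: K'_def subgroup.m_closed[OF KH] subgroup.m_inv_closed[OF KH] intro!: exI[of _ "\<one>"]
        subgroup.one_closed[OF KH])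
  define j where "j = inv_into ?C h"
  have j: "j d \<in> ?C" "h (j d) = d" if "d \<in> ?D" for d
    using that img by (simp_all add: j_def inv_into_into f_inv_into_f)
  have jh: "j (h c) = c" if "c \<in> ?C" for c using inj that by (simp add: j_def)
  have rD: "r k \<in> ?D" if "k \<in> K" for k using r that by (auto simp: hom_def)
  have "finite_index G K'"
  proof (rule G.finite_index_if_separated[OF K', where C = "rcosets\<^bsub>H\<^esub> K" and c = "\<lambda>x. K #>\<^bsub>H\<^esub> h x"])
    show "finite (rcosets\<^bsub>H\<^esub> K)" using K by (simp add: finite_index_def)
    show "K #>\<^bsub>H\<^esub> h x \<in> rcosets\<^bsub>H\<^esub> K" if "x \<in> carrier G" for x
      using that subgroup.subset[OF KH] by (intro H.rcosetsI) auto
    show "x \<otimes> inv y \<in> K'" if "x \<in> carrier G" "y \<in> carrier G" "K #>\<^bsub>H\<^esub> h x = K #>\<^bsub>H\<^esub> h y" for x y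
      using that KH by (simp add: K'_def H.r_coset_eq_iff)
  qed
  moreover have "?C \<subseteq> K'"
    using K(2) img subgroup.subset[OF C] by (auto simp: K'_def)
  moreover have "(\<lambda>x. j (r (h x))) \<in> hom (G\<lparr>carrier := K'\<rparr>) (G\<lparr>carrier := ?C\<rparr>)"
  proof (rule homI)
    show "j (r (h x)) \<in> carrier (G\<lparr>carrier := ?C\<rparr>)" if "x \<in> carrier (G\<lparr>carrier := K'\<rparr>)" for x
      using that j rD by (simp add: K'_def)
    fix x y assume "x \<in> carrier (G\<lparr>carrier := K'\<rparr>)" "y \<in> carrier (G\<lparr>carrier := K'\<rparr>)"
    then have x: "x \<in> carrier G" "h x \<in> K" and y: "y \<in> carrier G" "h y \<in> K" by (auto simp: K'_def)
    let ?a = "j (r (h x))" and ?b = "j (r (h y))"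
    have ab: "?a \<in> ?C" "?b \<in> ?C" using j rD x y by auto
    then have abG: "?a \<in> carrier G" "?b \<in> carrier G" using subgroup.mem_carrier[OF C] by auto
    have "r (h (x \<otimes> y)) = r (h x) \<otimes>\<^bsub>H\<^esub> r (h y)"
      using r x y by (auto simp: hom_def)
    \<comment> \<open>Multiplicativity of \<open>j\<close> is obtained here implicitly: the product
      is written as an image under \<open>h\<close> of an element of the cyclic group, which
      \<open>j\<close> then undoes.\<close>
    also have "\<dots> = h (?a \<otimes> ?b)" using abG j rD x y by simp
    finally show "j (r (h (x \<otimes>\<^bsub>G\<lparr>carrier := K'\<rparr>\<^esub> y))) = ?a \<otimes>\<^bsub>G\<lparr>carrier := ?C\<rparr>\<^esub> ?b"
      using jh[OF subgroup.m_closed[OF C ab]] by simp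
  qed
  moreover have "\<forall>c\<in>?C. j (r (h c)) = c" using jh r_id img by (metis imageI)
  ultimately show ?thesis using C unfolding virtual_retract_def by (intro conjI exI[of _ K'] bexI) auto
qed

lemma (in group_hom) exists_pow_in_kernel:
  assumes g: "g \<in> carrier G" and "\<not> inj_on h (generate G {g})"
  obtains k :: nat where "k > 0" "h (g [^] k) = \<one>\<^bsub>H\<^esub>" "g [^] k \<noteq> \<one>"
proof -
  obtain a b where ab: "a \<in> generate G {g}" "b \<in> generate G {g}" "h a = h b" "a \<noteq> b"
    using assms(2) by (auto simp: inj_on_def)
  obtain i j :: int where ij: "a = g [^] i" "b = g [^] j" using ab G.generate_pow[OF g] by auto
  have eq1: "h (g [^] (i - j)) = \<one>\<^bsub>H\<^esub>" if "h (g [^] i) = h (g [^] j)" for i j :: int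
    using that g by (simp add: G.int_pow_diff)
  have neq1: "g [^] (i - j) \<noteq> \<one>" if "g [^] i \<noteq> g [^] j" for i j :: int
  proof
    assume "g [^] (i - j) = \<one>"
    then have "g [^] (i - j) \<otimes> g [^] j = g [^] j" using g by simp
    then show False using that g G.int_pow_mult[OF g, of "i - j" j] by simp
  qed
  have "i \<noteq> j" using ab ij by auto
  then consider "i > j" | "j > i" by linarith
  then show thesis
  proof cases
    case 1
    then show thesis using that[of "nat (i - j)"] eq1[of i j] neq1[of i j] ab ij
      by (simp add: int_pow_int[of _ _ "nat (i - j)", symmetric])
  next
    case 2
    then show thesis using that[of "nat (j - i)"] eq1[of j i] neq1[of j i] ab ij
      by (simp add: int_pow_int[of _ _ "nat (j - i)", symmetric])
  qed
qed

text \<open>On the setwise stabilizer of the orbit \<open>Orb\<close> of \<open>\<beta>\<close> under \<open>g\<close>, the cocycle summed over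
  \<open>Orb\<close> is a homomorphism \<open>F\<close> to the integers. Since \<open>F (g\<^sup>k)\<close> is both \<open>k * F g\<close> and
  \<open>card Orb \<le> k\<close>, it takes the value \<open>1\<close> at \<open>g\<close>.\<close>

lemma (in group) virtual_retract_if_cocycle:
  fixes act :: "'a \<Rightarrow> 'z \<Rightarrow> 'z" and \<sigma> :: "'a \<Rightarrow> 'z \<Rightarrow> int"
  assumes fin: "finite B"
    and act: "\<And>x b. \<lbrakk>x \<in> carrier G; b \<in> B\<rbrakk> \<Longrightarrow> act x b \<in> B"
    and act_one: "\<And>b. b \<in> B \<Longrightarrow> act \<one> b = b"
    and act_mult: "\<And>x y b. \<lbrakk>x \<in> carrier G; y \<in> carrier G; b \<in> B\<rbrakk> \<Longrightarrow> act (x \<otimes> y) b = act x (act y b)"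
    and cocycle: "\<And>x y b. \<lbrakk>x \<in> carrier G; y \<in> carrier G; b \<in> B\<rbrakk>
      \<Longrightarrow> \<sigma> (x \<otimes> y) b = \<sigma> x (act y b) + \<sigma> y b"
    and g: "g \<in> carrier G" and k: "k > 0" and \<beta>: "\<beta> \<in> B"
    and per: "act (g [^] (k::nat)) \<beta> = \<beta>" and one: "\<sigma> (g [^] k) \<beta> = 1"
  shows "virtual_retract G (generate G {g})"
proof -
  define Orb where "Orb = (\<lambda>n::nat. act (g [^] n) \<beta>) ` {..<k}"
  have inj: "inj_on (act x) B" if "x \<in> carrier G" for x
  proof (rule inj_on_inverseI[where g = "act (inv x)"])
    show "act (inv x) (act x b) = b" if "b \<in> B" for b
      using act_mult[of "inv x" x b] act_one \<open>x \<in> carrier G\<close> that by simp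
  qed
  have OB: "Orb \<subseteq> B" using act \<beta> g by (auto simp: Orb_def)
  have finO: "finite Orb" by (simp add: Orb_def)
  have O0: "card Orb > 0" "card Orb \<le> k"
    using k finO card_image_le[of "{..<k}" "\<lambda>n::nat. act (g [^] n) \<beta>"]
    by (auto simp: Orb_def card_gt_0_iff)
  define K where "K = {x \<in> carrier G. act x ` Orb = Orb}"
  \<comment> \<open>An injective self-map of a finite set is onto, so membership in the stabilizer
    needs only an inclusion.\<close>
  have KI: "x \<in> K" if "x \<in> carrier G" "act x ` Orb \<subseteq> Orb" for x
    using that endo_inj_surj[OF finO that(2)] inj_on_subset[OF inj OB] by (auto simp: K_def)
  have KG: "x \<in> carrier G" if "x \<in> K" for x using that by (simp add: K_def)
  have gK: "g \<in> K"
  proof (rule KI[OF g], clarsimp simp: Orb_def)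
    fix n assume n: "n < k"
    have *: "act g (act (g [^] n) \<beta>) = act (g [^] Suc n) \<beta>"
      using act_mult[of g "g [^] n" \<beta>] nat_pow_Suc2[OF g, of n] g \<beta> by (simp del: nat_pow_Suc)
    show "act g (act (g [^] n) \<beta>) \<in> (\<lambda>n. act (g [^] n) \<beta>) ` {..<k}"
    proof (cases "Suc n = k")
      case True
      then have "act g (act (g [^] n) \<beta>) = act (g [^] (0::nat)) \<beta>"
        using per act_one \<beta> unfolding * by simp
      then show ?thesis using k by blast
    next
      case False
      then show ?thesis using n unfolding * by (intro imageI) simp
    qed
  qed
  have K: "subgroup K G"
  proof (rule subgroupI)
    show "K \<noteq> {}" using gK by blast
    show "x \<otimes> y \<in> K" if "x \<in> K" "y \<in> K" for x y
    proof (rule KI)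
      show "act (x \<otimes> y) ` Orb \<subseteq> Orb"
      proof clarify
        fix b assume b: "b \<in> Orb"
        then have "act y b \<in> Orb" using that(2) unfolding K_def by blast
        then have "act x (act y b) \<in> Orb" using that(1) unfolding K_def by blast
        then show "act (x \<otimes> y) b \<in> Orb" using that[THEN KG] b OB by (metis act_mult subsetD)
      qed
    qed (use that KG in simp)
    show "inv x \<in> K" if "x \<in> K" for x
    proof (rule KI)
      show "act (inv x) ` Orb \<subseteq> Orb"
      proof clarify
        fix b assume b: "b \<in> Orb"
        moreover have "act x ` Orb = Orb" using that by (simp add: K_def)
        ultimately obtain a where a: "a \<in> Orb" "b = act x a" by auto
        then have "act (inv x) b = a"
          using KG[OF that] OB act_one act_mult[of "inv x" x a] by auto
        then show "act (inv x) b \<in> Orb" using a by simp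
      qed
    qed (use that KG in simp)
  qed (use KG in auto)
  \<comment> \<open>The right coset of x is determined by the translate of \<open>Orb\<close> under
    the inverse of x, which is one of the finitely many subsets of \<open>B\<close>.\<close>
  have fiK: "finite_index G K"
  proof (rule finite_index_if_separated[OF K, where C = "Pow B" and c = "\<lambda>x. act (inv x) ` Orb"])
    show "act (inv x) ` Orb \<in> Pow B" if "x \<in> carrier G" for x using that act OB by auto
    show "x \<otimes> inv y \<in> K"
      if xy: "x \<in> carrier G" "y \<in> carrier G" and eq: "act (inv x) ` Orb = act (inv y) ` Orb" for x y
    proof (rule KI)
      show "act (x \<otimes> inv y) ` Orb \<subseteq> Orb"
      proof clarify
        fix b assume b: "b \<in> Orb"
        then obtain a where a: "a \<in> Orb" "act (inv y) b = act (inv x) a" using eq by blast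
        have "act (x \<otimes> inv y) b = act x (act (inv x) a)"
          using xy b OB a(2) act_mult[of x "inv y" b] by auto
        also have "\<dots> = a" using xy(1) a(1) OB act_one act_mult[of x "inv x" a] by auto
        finally show "act (x \<otimes> inv y) b \<in> Orb" using a by simp
      qed
    qed (use xy in auto)
  qed (use fin in simp)
  define F where "F x = (\<Sum>b\<in>Orb. \<sigma> x b)" for x
  have F_mult: "F (x \<otimes> y) = F x + F y" if "x \<in> K" "y \<in> K" for x y
  proof -
    have xy: "x \<in> carrier G" "y \<in> carrier G" and yO: "act y ` Orb = Orb"
      using that by (simp_all add: K_def)
    have "F (x \<otimes> y) = (\<Sum>b\<in>Orb. \<sigma> x (act y b)) + F y"
      unfolding F_def sum.distrib[symmetric] using xy OB by (intro sum.cong) (auto simp: cocycle)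
    also have "(\<Sum>b\<in>Orb. \<sigma> x (act y b)) = sum (\<sigma> x) (act y ` Orb)"
      using inj_on_subset[OF inj[OF xy(2)] OB] by (simp add: sum.reindex)
    finally show ?thesis by (simp add: yO F_def)
  qed
  have F_one: "F \<one> = 0" using F_mult[of \<one> \<one>] subgroup.one_closed[OF K] by simp
  have gnK: "g [^] n \<in> K" for n :: nat
    by (induction n) (simp_all add: subgroup.one_closed[OF K] subgroup.m_closed[OF K] gK)
  have F_pow: "F (g [^] n) = int n * F g" for n :: nat
    by (induction n) (simp_all add: F_one F_mult gnK gK algebra_simps)
  \<comment> \<open>The powers of \<open>g\<close> commute, so the cocycle at \<open>g^(n+k)\<close>
    can be expanded in both orders; hence the displacement 1 at \<open>\<beta>\<close> spreads to
    its whole orbit.\<close>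
  have "\<sigma> (g [^] k) (act (g [^] n) \<beta>) = 1" for n :: nat
  proof -
    have "\<sigma> (g [^] k) (act (g [^] n) \<beta>) + \<sigma> (g [^] n) \<beta> = \<sigma> (g [^] (n + k)) \<beta>"
      using g \<beta> cocycle[of "g [^] k" "g [^] n" \<beta>] by (simp add: nat_pow_mult add.commute)
    also have "\<dots> = \<sigma> (g [^] n) \<beta> + 1"
      using g \<beta> cocycle[of "g [^] n" "g [^] k" \<beta>] by (simp add: nat_pow_mult per one)
    finally show ?thesis by simp
  qed
  then have "F (g [^] k) = (\<Sum>b\<in>Orb. 1)" unfolding F_def by (intro sum.cong) (auto simp: Orb_def)
  then have card: "int (card Orb) = int k * F g" by (simp add: F_pow)
  have Fg: "F g = 1"
  proof -
    have "int k * F g \<le> int k * 1" "int k * F g > 0" using card O0 by linarith+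
    then show ?thesis using k by (simp add: zero_less_mult_iff)
  qed
  have C: "subgroup (generate G {g}) G" using g by (intro generate_is_subgroup) simp
  have CK: "generate G {g} \<subseteq> K" using gK K by (intro generate_subgroup_incl) auto
  have id: "g [^] F c = c" if "c \<in> generate G {g}" for c
    using that
  proof (induction rule: generate.induct)
    case one
    then show ?case by (simp add: F_one)
  next
    case (incl h)
    then show ?case using g by (simp add: Fg)
  next
    case (inv h)
    then have h: "h = g" by simp
    have "F (inv g) + F g = 0"
      using F_mult[of "inv g" g] gK subgroup.m_inv_closed[OF K gK] g by (simp add: F_one)
    then have "F (inv g) = -1" using Fg by simp
    then show ?case using g by (simp add: h int_pow_neg)
  next
    case (eng h1 h2)
    then have "h1 \<in> K" "h2 \<in> K" using CK by auto
    then show ?case using eng g by (simp add: F_mult int_pow_mult)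
  qed
  have "(\<lambda>x. g [^] F x) \<in> hom (G\<lparr>carrier := K\<rparr>) (G\<lparr>carrier := generate G {g}\<rparr>)"
  proof (rule homI)
    show "g [^] F x \<in> carrier (G\<lparr>carrier := generate G {g}\<rparr>)" for x
      using generate_pow[OF g] by auto
  qed (use g in \<open>simp add: F_mult int_pow_mult\<close>)
  moreover have "\<forall>c\<in>generate G {g}. g [^] F c = c" using id by simp
  ultimately show ?thesis
    unfolding virtual_retract_def by (intro conjI C exI[of _ K] fiK CK bexI[of _ "\<lambda>x. g [^] F x"])
qed

section \<open>Trees\<close>

lemma not_successively_decomp:
  assumes "\<not> successively R p"
  obtains a x y b where "p = a @ x # y # b" "\<not> R x y"
proof -
  have "\<exists>a x y b. p = a @ x # y # b \<and> \<not> R x y"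
    using assms
  proof (induction p rule: induct_list012)
    case (3 x y zs)
    show ?case
    proof (cases "R x y")
      case True
      then obtain a x' y' b where "y # zs = a @ x' # y' # b" "\<not> R x' y'" using 3 by auto
      then show ?thesis by (intro exI[of _ "x # a"]) auto
    next
      case False
      then show ?thesis by (intro exI[of _ "[]"]) auto
    qed
  qed auto
  then show thesis using that by blast
qed

text \<open>A vertex repeated after the first edge bounds a shorter closed walk that is a contiguous
  piece of \<open>p\<close>, and contiguous pieces inherit \<open>successively\<close>. Nothing is
  asked about the last edge followed by the first, in agreement with
  \<open>serre_tree\<close>.\<close>

lemma (in wf_digraph) closed_successively_imp_cycle:
  assumes "awalk u p u" "p \<noteq> []" "successively R p"
  shows "\<exists>q. cycle q \<and> successively R q"
  using assms
proof (induction "length p" arbitrary: u p rule: less_induct)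
  case less
  show ?case
  proof (cases "distinct (tl (awalk_verts u p))")
    case True
    then show ?thesis using less.prems by (auto simp: cycle_def)
  next
    case False
    obtain e p' where p: "p = e # p'" using less.prems by (cases p) auto
    then have "awalk (head G e) p' u" "\<not> distinct (awalk_verts (head G e) p')"
      using less.prems False by (auto simp: awalk_Cons_iff)
    then obtain q r s w where p': "p' = q @ r @ s" and r: "0 < length r" "awalk w r w"
      using awalk_not_distinct_decomp[of "head G e" p' u] by blast
    then show ?thesis
      using less.prems(3) by (intro less.hyps[OF _ r(2)]) (simp_all add: p successively_Cons successively_append_iff)
  qed
qed

text \<open>A \<open>bidirected_digraph\<close> has an inversion that is the identity off its arcs,
  which fails for a subgraph with fewer arcs and the same inversion. This locale keeps only
  conditions on the arcs, so that it applies to trees inside the graph.\<close>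

locale serre_graph = wf_digraph G for G :: "('v, 'e) pre_digraph" +
  fixes arev :: "'e \<Rightarrow> 'e"
  assumes arev_arcs: "e \<in> arcs G \<Longrightarrow> arev e \<in> arcs G"
    and arev_arev: "e \<in> arcs G \<Longrightarrow> arev (arev e) = e"
    and tail_arev: "e \<in> arcs G \<Longrightarrow> tail G (arev e) = head G e"
begin

lemma head_arev: "e \<in> arcs G \<Longrightarrow> head G (arev e) = tail G e"
  using tail_arev[of "arev e"] arev_arcs arev_arev by simp

lemma symmetric: "symmetric G"
  unfolding symmetric_conv using arev_arcs tail_arev head_arev by metis

lemma connected_imp_awalk:
  assumes "Digraph_Component.connected G" "u \<in> verts G" "v \<in> verts G"
  shows "\<exists>p. awalk u p v"
  using symmetric_connected_imp_strongly_connected[OF symmetric assms(1)] assms(2,3)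
  by (auto simp: strongly_connected_def reachable_awalk)

lemma awalk_rev: "awalk u p v \<Longrightarrow> awalk v (map arev (rev p)) u"
proof (induction p arbitrary: u)
  case (Cons e p)
  then have e: "e \<in> arcs G" "u = tail G e" and IH: "awalk v (map arev (rev p)) (head G e)"
    by (auto simp: awalk_Cons_iff)
  have "awalk (head G e) [arev e] (tail G e)"
    using e arev_arcs[of e] tail_arev[of e] head_arev[of e] by (simp add: awalk_Cons_iff awalk_Nil_iff)
  from awalk_appendI[OF IH this] show ?case using e by simp
qed (simp add: awalk_Nil_iff)

text \<open>The product of the labels along a closed walk is trivial, since such a walk backtracks
  somewhere.\<close>

lemma tree_potential:
  assumes tree: "serre_tree G arev" and H: "group H"
    and r: "\<And>e. e \<in> arcs G \<Longrightarrow> r e \<in> carrier H"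
    and r_arev: "\<And>e. e \<in> arcs G \<Longrightarrow> r (arev e) = inv\<^bsub>H\<^esub> r e"
  obtains w where "\<And>v. v \<in> verts G \<Longrightarrow> w v \<in> carrier H"
    and "\<And>e. e \<in> arcs G \<Longrightarrow> w (head G e) = w (tail G e) \<otimes>\<^bsub>H\<^esub> r e"
proof -
  interpret H: group H by (rule H)
  define W where "W = (\<lambda>p. foldr (\<lambda>e x. r e \<otimes>\<^bsub>H\<^esub> x) p \<one>\<^bsub>H\<^esub>)"
  have W_simps: "W [] = \<one>\<^bsub>H\<^esub>" "W (e # p) = r e \<otimes>\<^bsub>H\<^esub> W p" for e p by (simp_all add: W_def)
  have W: "W p \<in> carrier H" if "set p \<subseteq> arcs G" for p
    using that by (induction p) (auto simp: W_simps r)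
  have W_append: "W (p @ q) = W p \<otimes>\<^bsub>H\<^esub> W q" if "set p \<subseteq> arcs G" "set q \<subseteq> arcs G" for p q
    using that by (induction p) (auto simp: W_simps W r H.m_assoc)
  have W_rev: "W (map arev (rev p)) = inv\<^bsub>H\<^esub> W p" if "set p \<subseteq> arcs G" for p
    using that
  proof (induction p)
    case (Cons e p)
    then have "set (map arev (rev p)) \<subseteq> arcs G" using arev_arcs by auto
    then show ?case using Cons by (simp add: W_append W_simps W r r_arev arev_arcs H.inv_mult_group)
  qed (simp add: W_simps)
  have closed: "W p = \<one>\<^bsub>H\<^esub>" if "awalk u p u" for u p
    using that
  proof (induction "length p" arbitrary: p rule: less_induct)
    case less
    show ?case
    proof (cases "p = []")
      case False
      have "\<not> successively (\<lambda>e f. f \<noteq> arev e) p"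
        using closed_successively_imp_cycle[OF less.prems False] tree
        unfolding serre_tree_def by blast
      then obtain a e f b where p: "p = a @ e # f # b" "f = arev e"
        by (elim not_successively_decomp) auto
      have w: "awalk u a (tail G e)" "awalk (tail G e) b u" "e \<in> arcs G"
        using less.prems by (auto simp: p awalk_Cons_iff head_arev)
      then have ab: "set a \<subseteq> arcs G" "set b \<subseteq> arcs G" by auto
      have "W (a @ b) = \<one>\<^bsub>H\<^esub>" using w by (intro less.hyps) (auto simp: p intro: awalk_appendI)
      moreover have "r e \<otimes>\<^bsub>H\<^esub> (inv\<^bsub>H\<^esub> r e \<otimes>\<^bsub>H\<^esub> W b) = W b"
        using w(3) ab by (simp add: r W flip: H.m_assoc)
      ultimately show ?thesis
        using w(3) ab arev_arcs by (simp add: p W_append W_simps r_arev)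
    qed (simp add: W_simps)
  qed
  have conn: "Digraph_Component.connected G" using tree by (simp add: serre_tree_def)
  then obtain v0 where v0: "v0 \<in> verts G" by (auto simp: connected_conv)
  \<comment> \<open>The potential is the product of labels along a walk from \<open>v0\<close>.
    Since closed walks have trivial product, following an edge and then returning along the chosen
    walk compares the potentials at its two ends.\<close>
  define path where "path v = (SOME p. awalk v0 p v)" for v
  have path: "awalk v0 (path v) v" if "v \<in> verts G" for v
    unfolding path_def using connected_imp_awalk[OF conn v0 that] by (rule someI_ex)
  show thesis
  proof (rule that)
    show "W (path v) \<in> carrier H" if "v \<in> verts G" for v using path[OF that] W by blast
    show "W (path (head G e)) = W (path (tail G e)) \<otimes>\<^bsub>H\<^esub> r e" if e: "e \<in> arcs G" for e
    proof -
      let ?p = "path (tail G e)" and ?q = "path (head G e)"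
      have p: "awalk v0 ?p (tail G e)" and q: "awalk v0 ?q (head G e)" using path e by auto
      then have sets: "set ?p \<subseteq> arcs G" "set ?q \<subseteq> arcs G" "set (map arev (rev ?q)) \<subseteq> arcs G"
        using arev_arcs by auto
      have cl: "awalk v0 (?p @ [e] @ map arev (rev ?q)) v0"
        by (rule awalk_appendI[OF p awalk_appendI[OF arc_implies_awalk[OF e] awalk_rev[OF q]]])
      then have "W ?p \<otimes>\<^bsub>H\<^esub> (r e \<otimes>\<^bsub>H\<^esub> inv\<^bsub>H\<^esub> W ?q) = \<one>\<^bsub>H\<^esub>"
        using closed[OF cl] sets e by (simp add: W_append W_simps W_rev)
      then have "W ?p \<otimes>\<^bsub>H\<^esub> r e \<otimes>\<^bsub>H\<^esub> inv\<^bsub>H\<^esub> W ?q = \<one>\<^bsub>H\<^esub>"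
        using sets e r W by (simp add: H.m_assoc)
      then have "inv\<^bsub>H\<^esub> (inv\<^bsub>H\<^esub> W ?q) = W ?p \<otimes>\<^bsub>H\<^esub> r e"
        using sets W r[OF e] by (intro H.inv_equality) simp_all
      then show ?thesis using sets W by simp
    qed
  qed
qed

end

lemma serre_graph_subgraph:
  assumes "bidirected_digraph G arev" "subgraph T G" "arev ` arcs T \<subseteq> arcs T"
  shows "serre_graph T arev"
proof -
  interpret bidirected_digraph G arev by fact
  interpret T: wf_digraph T using assms(2) by auto
  have "tail T = tail G" "head T = head G" "arcs T \<subseteq> arcs G"
    using assms(2) by (auto simp: subgraph_def compatible_def)
  then show ?thesis
    using assms(3) by unfold_locales auto
qed

text \<open>Otherwise an edge that leaves the tree could be added to it: a closed walk without backtracking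
  visits the new vertex at most at its end points, and the rest of it is a closed walk in the old tree.\<close>

lemma maximal_tree_spanning:
  assumes bd: "bidirected_digraph G arev" and conn: "Digraph_Component.connected G"
    and max: "maximal_tree T G arev"
  shows "verts T = verts G"
proof (rule ccontr)
  assume "verts T \<noteq> verts G"
  interpret bidirected_digraph G arev by (rule bd)
  have sub: "subgraph T G" and inv: "arev ` arcs T \<subseteq> arcs T" and tree: "serre_tree T arev"
    using max unfolding maximal_tree_def max_subgraph_def by simp_all
  have maxT: "\<And>T'. \<lbrakk>T' \<noteq> T; subgraph T T'; subgraph T' G; arev ` arcs T' \<subseteq> arcs T'\<rbrakk> \<Longrightarrow> \<not> serre_tree T' arev"
    using max unfolding maximal_tree_def max_subgraph_def by blast+
  interpret T: serre_graph T arev using bd sub inv by (rule serre_graph_subgraph)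
  have th: "tail T = tail G" "head T = head G" using sub by (auto simp: subgraph_def compatible_def)
  have connT: "Digraph_Component.connected T" using tree by (simp add: serre_tree_def)
  obtain x where x: "x \<in> verts T" using connT by (auto simp: connected_conv)
  obtain u where u: "u \<in> verts G" "u \<notin> verts T" using sub \<open>verts T \<noteq> verts G\<close> by auto
  have "x \<in> verts G" using x sub by auto
  then have "x \<rightarrow>\<^sup>*\<^bsub>G\<^esub> u"
    using symmetric_connected_imp_strongly_connected[OF sym_arcs conn] u
    by (auto simp: strongly_connected_def)
  then obtain p where "awalk x p u" by (auto simp: reachable_awalk)
  then have "\<exists>e\<in>arcs G. tail G e \<in> verts T \<and> head G e \<notin> verts T"
    using x u(2) by (induction p arbitrary: x) (auto simp: awalk_Nil_iff awalk_Cons_iff)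
  then obtain e where e: "e \<in> arcs G" "tail G e \<in> verts T" "head G e \<notin> verts T" by blast
  let ?y = "tail G e" and ?z = "head G e"
  define T' where "T' = \<lparr>verts = insert ?z (verts T), arcs = insert e (insert (arev e) (arcs T)),
    tail = tail G, head = head G\<rparr>"
  have T'_simps: "verts T' = insert ?z (verts T)" "arcs T' = insert e (insert (arev e) (arcs T))"
    "tail T' = tail G" "head T' = head G" by (simp_all add: T'_def)
  have endsT: "tail G f \<in> verts T" "head G f \<in> verts T" if "f \<in> arcs T" for f
    using T.wellformed[OF that] by (simp_all add: th)
  interpret T': serre_graph T' arev
    using e endsT inv T.arev_arev T.tail_arev by unfold_locales (auto simp: T'_simps th)
  have sub': "subgraph T' G"
    using e sub T'.wf_digraph wf_digraph arev_in_arcs[of e] head_in_verts[of e]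
    by (auto simp: subgraph_def compatible_def T'_simps)
  have subT: "subgraph T T'"
    using T.wf_digraph T'.wf_digraph by (auto simp: subgraph_def compatible_def T'_simps th)
  have "T' \<noteq> T" using e T'_simps(1) by auto
  moreover have "arev ` arcs T' \<subseteq> arcs T'" using inv by (auto simp: T'_simps)
  moreover have "serre_tree T' arev"
    unfolding serre_tree_def
  proof (intro conjI notI)
    have "strongly_connected T" by (rule T.symmetric_connected_imp_strongly_connected[OF T.symmetric connT])
    then have old: "a \<rightarrow>\<^sup>*\<^bsub>T'\<^esub> b" if "a \<in> verts T" "b \<in> verts T" for a b
      using that T'.reachable_mono[OF _ subT] by (auto simp: strongly_connected_def)
    have new: "?y \<rightarrow>\<^sup>*\<^bsub>T'\<^esub> ?z" "?z \<rightarrow>\<^sup>*\<^bsub>T'\<^esub> ?y"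
      using T'.in_arcs_imp_in_arcs_ends[of e] T'.in_arcs_imp_in_arcs_ends[of "arev e"] e
      by (auto simp: T'_simps)
    have "a \<rightarrow>\<^sup>*\<^bsub>T'\<^esub> b" if "a \<in> verts T'" "b \<in> verts T'" for a b
    proof -
      have "a \<rightarrow>\<^sup>*\<^bsub>T'\<^esub> ?y" "?y \<rightarrow>\<^sup>*\<^bsub>T'\<^esub> b" using that old new e(2) by (auto simp: T'_simps)
      then show ?thesis by (rule T'.reachable_trans)
    qed
    then show "Digraph_Component.connected T'"
      unfolding Digraph_Component.connected_def strongly_connected_def
      using T'.symmetric x by (auto simp: T'.reachable_mk_symmetric_eq T'_simps)
    let ?red = "successively (\<lambda>e f. f \<noteq> arev e)"
    assume "\<exists>p. T'.cycle p \<and> ?red p"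
    then obtain p v where p: "T'.awalk v p v" "p \<noteq> []" and red: "?red p"
      by (auto simp: T'.cycle_def)
    have no_closed: False if "T.awalk v q v" "q \<noteq> []" "?red q" for v q
      using T.closed_successively_imp_cycle[OF that] tree by (auto simp: serre_tree_def)
    have restrict: "T.awalk a q b" if "T'.awalk a q b" "set q \<subseteq> arcs T" "q \<noteq> []" for a q b
      using that endsT by (cases q)
        (auto simp: T.awalk_def T'.awalk_def T'_simps th compatible_cas[of T' T] compatible_def)
    have out: "f = arev e" if "f \<in> arcs T'" "tail G f = ?z" for f
      using that e endsT(1)[of f] by (auto simp: T'_simps)
    have into: "f = e" if "f \<in> arcs T'" "head G f = ?z" for f
      using that e endsT(2)[of f] by (auto simp: T'_simps)
    \<comment> \<open>The new vertex has \<open>arev e\<close> as its only outgoing and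
      \<open>e\<close> as its only incoming arc. A walk continuing after \<open>e\<close>, or
      arriving before \<open>arev e\<close>, would therefore backtrack.\<close>
    have e_last: "b = []" if "p = a @ e # b" for a b
      using that p red out by (cases b) (auto simp: T'.awalk_Cons_iff successively_append_iff T'_simps(3,4))
    have arev_first: "a = []" if "p = a @ arev e # b" for a b
    proof (cases a rule: rev_cases)
      case (snoc a' f)
      then have "T'.awalk v (a' @ f # arev e # b) v" using p that by simp
      then have "f \<in> arcs T'" "head G f = ?z"
        using e by (auto simp: T'.awalk_Cons_iff T'_simps(3,4))
      then have "f = e" by (rule into)
      then show ?thesis using red by (auto simp: that snoc successively_append_iff)
    qed
    have last_v: "head G (last p) = v"
      using p T'.awlast_of_awalk[OF p(1)] by (simp add: T'.awalk_verts_conv T'_simps split: if_splits)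
    have in_T': "set p \<subseteq> arcs T'" using p by auto
    have hd_v: "tail G (hd p) = v" using p by (cases p) (auto simp: T'.awalk_Cons_iff T'_simps)
    show False
    proof (cases "v = ?z")
      case True
      then have "hd p = arev e" "last p = e"
        using p(2) in_T' hd_v last_v by (auto intro!: out into)
      moreover have "arev e \<noteq> e" using e arev_neq by blast
      ultimately obtain q where q: "p = arev e # q @ [e]"
        using p(2) by (metis append_butlast_last_id last_ConsL last_ConsR list.exhaust_sel)
      have "set q \<subseteq> arcs T"
      proof
        fix f assume f: "f \<in> set q"
        then obtain a b where "q = a @ f # b" by (auto dest: split_list)
        then have "f \<noteq> e" "f \<noteq> arev e"
          using e_last[of "arev e # a" "b @ [e]"] arev_first[of "arev e # a" "b @ [e]"] q by auto
        then show "f \<in> arcs T" using in_T' f q by (auto simp: T'_simps)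
      qed
      \<comment> \<open>An empty \<open>q\<close> would leave \<open>arev e\<close> followed
        directly by \<open>e\<close>, which backtracks.\<close>
      moreover have "q \<noteq> []" using red q arev_arev by auto
      moreover have "T'.awalk ?y q ?y"
        using p(1) e by (auto simp: q T'.awalk_Cons_iff T'_simps(3,4))
      moreover have "?red q" using red by (auto simp: q successively_Cons successively_append_iff)
      ultimately show False using no_closed restrict by blast
    next
      case False
      have "f \<in> arcs T" if f: "f \<in> set p" for f
      proof -
        obtain a b where ab: "p = a @ f # b" using f by (auto dest: split_list)
        have "f \<noteq> e" using e_last[of a b] ab last_v False by auto
        moreover have "f \<noteq> arev e" using arev_first[of a b] ab hd_v False e by auto
        ultimately show ?thesis using in_T' f by (auto simp: T'_simps)
      qed
      then show False using no_closed restrict p red by blast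
    qed
  qed
  ultimately show False using maxT subT sub' by blast
qed

section \<open>Reduced words acting as translations\<close>

fun flip :: "'x \<times> bool \<Rightarrow> 'x \<times> bool" where
  "flip (x, b) = (x, \<not> b)"

lemma flip_flip [simp]: "flip (flip s) = s"
  by (cases s) simp

lemma flip_neq [simp]: "flip s \<noteq> s" "s \<noteq> flip s"
  by (cases s; simp)+

definition inv_word :: "'x word \<Rightarrow> 'x word" where
  "inv_word u = map flip (rev u)"

abbreviation reduced :: "'x word \<Rightarrow> bool" where
  "reduced \<equiv> successively (\<lambda>s t. t \<noteq> flip s)"

lemma reduced_rev: "reduced (rev u) \<longleftrightarrow> reduced u"
  by (auto simp: successively_rev elim!: successively_mono)

text \<open>Mutually inverse end letters are peeled off as long as possible. The core never becomes
  empty, because a letter followed by its own inverse is not reduced.\<close>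

lemma reduced_decomp:
  assumes "reduced u" "u \<noteq> []"
  obtains p c where "u = p @ c @ inv_word p" "c \<noteq> []" "reduced c" "hd c \<noteq> flip (last c)"
proof -
  have "\<exists>p c. u = p @ c @ inv_word p \<and> c \<noteq> [] \<and> reduced c \<and> hd c \<noteq> flip (last c)"
    using assms
  proof (induction "length u" arbitrary: u rule: less_induct)
    case less
    show ?case
    proof (cases "hd u = flip (last u)")
      case False
      then show ?thesis using less.prems by (intro exI[of _ "[]"] exI[of _ u]) (simp add: inv_word_def)
    next
      case True
      then obtain s v where u: "u = s # v @ [flip s]"
        using less.prems(2) by (metis append_butlast_last_id flip_flip flip_neq(1) last_ConsL last_ConsR list.exhaust_sel)
      then have "v \<noteq> []" "reduced v"
        using less.prems(1) by (auto simp: successively_Cons successively_append_iff)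
      with less.hyps[of v] u obtain p c where
        "v = p @ c @ inv_word p" "c \<noteq> []" "reduced c" "hd c \<noteq> flip (last c)" by auto
      then show ?thesis
        by (intro exI[of _ "s # p"] exI[of _ c]) (simp add: u inv_word_def)
    qed
  qed
  then show thesis using that by blast
qed

definition cyc :: "'a list \<Rightarrow> int \<Rightarrow> 'a" where
  "cyc c i = c ! nat (i mod int (length c))"

lemma cyc_shift: "cyc c (i + n * int (length c)) = cyc c i"
  by (simp add: cyc_def)

lemma cyc_nth: "n < length c \<Longrightarrow> cyc c (int n) = c ! n"
  by (simp add: cyc_def)

text \<open>Stated for the periodic bi-infinite word, so that the passage from the last letter to
  the first is not a special case.\<close>

definition cyclically_reduced :: "'x word \<Rightarrow> bool" where
  "cyclically_reduced c \<longleftrightarrow> (\<forall>i. cyc c (i + 1) \<noteq> flip (cyc c i))"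

lemma cyclically_reducedI:
  assumes "c \<noteq> []" "reduced c" "hd c \<noteq> flip (last c)"
  shows "cyclically_reduced c"
  unfolding cyclically_reduced_def
proof
  fix i
  let ?L = "int (length c)"
  define n where "n = nat (i mod ?L)"
  have L: "?L > 0" using assms(1) by simp
  have n: "n < length c" "int n = i mod ?L" using L by (simp_all add: n_def nat_less_iff)
  have i: "cyc c i = c ! n" by (simp add: cyc_def n_def)
  have i1: "(i + 1) mod ?L = int (Suc n) mod ?L"
    by (metis n(2) mod_add_left_eq of_nat_Suc add.commute)
  show "cyc c (i + 1) \<noteq> flip (cyc c i)"
  proof (cases "Suc n = length c")
    case True
    then have "cyc c (i + 1) = hd c" using assms(1) by (simp add: cyc_def i1 hd_conv_nth)
    moreover have "last c = c ! n" using assms(1) True by (simp add: last_conv_nth flip: True)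
    ultimately show ?thesis using assms(3) i by simp
  next
    case False
    then have "int (Suc n) mod ?L = int (Suc n)" using n(1) by (simp del: of_nat_Suc)
    then have "cyc c (i + 1) = c ! Suc n" by (simp add: cyc_def i1 del: of_nat_Suc)
    then show ?thesis using assms(2) i False n(1) by (simp add: successively_conv_nth)
  qed
qed

text \<open>A cyclically reduced word \<open>c\<close> of length \<open>L\<close> is written repeatedly along the integers, the
  letter \<open>cyc c i\<close> labelling the edge from \<open>i\<close> to \<open>i + 1\<close>. Following the edges labelled by a
  fixed letter is a partial injection of the integers, defined by \<open>move\<close>.
  It is completed to a permutation \<open>turn\<close> of two copies of the integers: its inverse is used on the
  second copy, and a point without an edge to follow is sent to its twin.\<close>

definition move :: "'x word \<Rightarrow> 'x \<times> bool \<Rightarrow> int \<Rightarrow> int option" where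
  "move c s i =
    (if cyc c i = s then Some (i + 1) else if cyc c (i - 1) = flip s then Some (i - 1) else None)"

definition turn :: "'x word \<Rightarrow> 'x \<times> bool \<Rightarrow> int \<times> bool \<Rightarrow> int \<times> bool" where
  "turn c s y = (case move c (if snd y then flip s else s) (fst y) of
    Some j \<Rightarrow> (j, snd y) | None \<Rightarrow> (fst y, \<not> snd y))"

definition shift :: "int \<Rightarrow> int \<times> bool \<Rightarrow> int \<times> bool" where
  "shift n y = (fst y + n, snd y)"

text \<open>Cyclic reducedness means that the labelled line is folded in the sense of Stallings: the
  two edges leaving a point carry different letters. Hence the order of the tests in
  \<open>move\<close> is harmless and each step can be retraced.\<close>

lemma move_flip:
  assumes "cyclically_reduced c" "move c s i = Some j"
  shows "move c (flip s) j = Some i"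
proof (cases "cyc c i = s")
  case True
  then have "j = i + 1" using assms(2) by (simp add: move_def)
  moreover have "cyc c (i + 1) \<noteq> flip s"
    using assms(1) True unfolding cyclically_reduced_def by blast
  ultimately show ?thesis using True by (simp add: move_def)
next
  case False
  then have "cyc c (i - 1) = flip s" "j = i - 1"
    using assms(2) by (auto simp: move_def split: if_splits)
  then show ?thesis by (simp add: move_def)
qed

text \<open>On the twin copy \<open>flip s\<close> follows the same partial injection as
  \<open>s\<close> does on the original one, so a point sent to its twin for lack of an edge is sent
  back.\<close>

lemma turn_flip:
  assumes "cyclically_reduced c"
  shows "turn c (flip s) (turn c s y) = y"
proof (cases y)
  case (Pair i l)
  show ?thesis
  proof (cases "move c (if l then flip s else s) i")
    case None
    then show ?thesis by (cases l) (simp_all add: turn_def Pair)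
  next
    case (Some j)
    then show ?thesis using move_flip[OF assms Some] by (cases l) (simp_all add: turn_def Pair)
  qed
qed

lemma turn_shift: "turn c s (shift (n * int (length c)) y) = shift (n * int (length c)) (turn c s y)"
proof -
  have "cyc c (i + n * int (length c) - 1) = cyc c (i - 1)" for i
    using cyc_shift[of c "i - 1" n] by (simp add: algebra_simps)
  then show ?thesis
    by (auto simp: turn_def move_def shift_def cyc_shift split: option.split)
qed

lemma foldr_turn_shift:
  "foldr (turn c) u (shift (n * int (length c)) y) = shift (n * int (length c)) (foldr (turn c) u y)"
  by (induction u) (simp_all add: turn_shift)

lemma foldr_turn_inv_word:
  assumes "cyclically_reduced c"
  shows "foldr (turn c) (inv_word u) (foldr (turn c) u y) = y"
  by (induction u arbitrary: y) (simp_all add: inv_word_def turn_flip[OF assms])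

text \<open>In \<open>foldr\<close> the last letter acts first, while the line is traversed upwards
  from 0; the line therefore carries the reversed word.\<close>

lemma foldr_turn_cyclic: "foldr (turn (rev c)) c (0, False) = (int (length c), False)"
proof -
  have "fold (turn d) (take n d) (0, False) = (int n, False)" if "n \<le> length d" for d :: "'a word" and n
    using that
  proof (induction n)
    case (Suc n)
    then show ?case by (simp add: take_Suc_conv_app_nth turn_def move_def cyc_nth)
  qed simp
  from this[of "length c" "rev c"] show ?thesis by (simp add: foldr_conv_fold)
qed

text \<open>The cyclically reduced core translates the origin of the first copy. The conjugating
  word \<open>p\<close> commutes with the shift, so the whole word translates the image of the
  origin under \<open>p\<close>.\<close>

lemma reduced_word_translates:
  assumes "reduced u" "u \<noteq> []"
  obtains c y where "c \<noteq> []" "cyclically_reduced c" "foldr (turn c) u y = shift (int (length c)) y"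
proof -
  obtain p d where u: "u = p @ d @ inv_word p" "d \<noteq> []" "reduced d" "hd d \<noteq> flip (last d)"
    using reduced_decomp[OF assms] by blast
  let ?c = "rev d"
  have "hd ?c \<noteq> flip (last ?c)" using u(2,4) by (metis flip_flip hd_rev last_rev)
  then have c: "cyclically_reduced ?c"
    using u(2,3) by (intro cyclically_reducedI) (simp_all only: reduced_rev rev_is_Nil_conv not_False_eq_True)
  let ?y = "foldr (turn ?c) p (0, False)"
  have "foldr (turn ?c) u ?y = foldr (turn ?c) p (foldr (turn ?c) d (0, False))"
    using foldr_turn_inv_word[OF c] by (simp add: u(1))
  also have "\<dots> = foldr (turn ?c) p (shift (1 * int (length ?c)) (0, False))"
    by (simp add: foldr_turn_cyclic shift_def)
  also have "\<dots> = shift (int (length ?c)) ?y"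
    by (subst foldr_turn_shift) simp
  finally show thesis using that c u(2) by blast
qed

section \<open>Permutations commuting with translations\<close>

text \<open>Permutations of the whole type are taken, so that the group law is plain composition;
  the invariant set \<open>Y\<close> will mark the points over the carrier of the finite group.
  Invariance is an equivalence in order to pass to inverses.\<close>

definition equivariant_perms :: "'y set \<Rightarrow> ('y \<Rightarrow> 'y) set \<Rightarrow> ('y \<Rightarrow> 'y) monoid" where
  "equivariant_perms Y S =
    \<lparr>carrier = {\<pi>. bij \<pi> \<and> (\<forall>y. \<pi> y \<in> Y \<longleftrightarrow> y \<in> Y) \<and> (\<forall>t\<in>S. \<forall>y. \<pi> (t y) = t (\<pi> y))},
     monoid.mult = (\<circ>), one = id\<rparr>"

lemma equivariant_perms_simps [simp]:
  "a \<otimes>\<^bsub>equivariant_perms Y S\<^esub> b = a \<circ> b" "\<one>\<^bsub>equivariant_perms Y S\<^esub> = id"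
  by (simp_all add: equivariant_perms_def)

lemma in_equivariant_perms:
  "\<pi> \<in> carrier (equivariant_perms Y S) \<longleftrightarrow>
    bij \<pi> \<and> (\<forall>y. \<pi> y \<in> Y \<longleftrightarrow> y \<in> Y) \<and> (\<forall>t\<in>S. \<forall>y. \<pi> (t y) = t (\<pi> y))"
  by (simp add: equivariant_perms_def)

lemma equivariant_permsD:
  assumes "\<pi> \<in> carrier (equivariant_perms Y S)"
  shows "\<pi> y \<in> Y \<longleftrightarrow> y \<in> Y" and "t \<in> S \<Longrightarrow> \<pi> (t y) = t (\<pi> y)"
  using assms by (simp_all add: in_equivariant_perms)

lemma group_equivariant_perms: "group (equivariant_perms Y S)"
proof (rule groupI)
  fix \<pi> assume "\<pi> \<in> carrier (equivariant_perms Y S)"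
  then have \<pi>: "bij \<pi>" "\<And>y. \<pi> y \<in> Y \<longleftrightarrow> y \<in> Y" "\<And>t y. t \<in> S \<Longrightarrow> \<pi> (t y) = t (\<pi> y)"
    by (auto simp: in_equivariant_perms)
  have inv: "\<pi> (inv_into UNIV \<pi> y) = y" "inv_into UNIV \<pi> (\<pi> y) = y" for y
    using \<pi>(1) by (simp_all add: bij_is_surj surj_f_inv_f bij_is_inj)
  have "inv_into UNIV \<pi> \<in> carrier (equivariant_perms Y S)"
    unfolding in_equivariant_perms using \<pi> bij_imp_bij_inv inv by metis
  moreover have "inv_into UNIV \<pi> \<circ> \<pi> = id" using inv by auto
  ultimately show "\<exists>\<rho>\<in>carrier (equivariant_perms Y S).
      \<rho> \<otimes>\<^bsub>equivariant_perms Y S\<^esub> \<pi> = \<one>\<^bsub>equivariant_perms Y S\<^esub>"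
    by auto
qed (auto simp: in_equivariant_perms bij_comp)

lemma equivariant_permsI:
  assumes "\<And>y. \<rho> (\<pi> y) = y" "\<And>y. \<pi> (\<rho> y) = y" "\<And>y. y \<in> Y \<Longrightarrow> \<pi> y \<in> Y" "\<And>y. y \<in> Y \<Longrightarrow> \<rho> y \<in> Y"
    and "\<And>t y. t \<in> S \<Longrightarrow> \<pi> (t y) = t (\<pi> y)"
  shows "\<pi> \<in> carrier (equivariant_perms Y S)"
proof -
  have "bij \<pi>" using assms(1,2) by (intro o_bij[of \<rho>]) auto
  moreover have "\<pi> y \<in> Y \<longleftrightarrow> y \<in> Y" for y using assms(1,3,4) by metis
  ultimately show ?thesis using assms(5) by (simp add: in_equivariant_perms)
qed

definition translate :: "int \<Rightarrow> int \<Rightarrow> 'q \<times> int \<times> bool \<Rightarrow> 'q \<times> int \<times> bool" where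
  "translate L n z = (fst z, shift (n * L) (snd z))"

text \<open>An action that commutes with the translation by \<open>L\<close> descends to the finite
  set of representatives with integer coordinate in \<open>{0..<L}\<close>. The number
  \<open>ht\<close> of translations split off by division with remainder is a cocycle for the
  descended action.\<close>

lemma (in group) virtual_retract_if_translation:
  fixes \<psi> :: "'a \<Rightarrow> 'q \<times> int \<times> bool \<Rightarrow> 'q \<times> int \<times> bool"
  assumes fin: "finite B" and L: "L > 0"
    and \<psi>: "\<psi> \<in> hom G (equivariant_perms (B \<times> UNIV) (range (translate L)))"
    and g: "g \<in> carrier G" and k: "k > 0" and z: "fst z \<in> B"
    and gz: "\<psi> (g [^] (k::nat)) z = translate L 1 z"
  shows "virtual_retract G (generate G {g})"
proof -
  define red where "red z = (fst z, fst (snd z) mod L, snd (snd z))" for z :: "'q \<times> int \<times> bool"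
  define ht where "ht z = fst (snd z) div L" for z :: "'q \<times> int \<times> bool"
  have split: "z = translate L (ht z) (red z)" for z
    by (simp add: translate_def shift_def red_def ht_def prod_eq_iff)
  have red: "red (translate L n z) = red z" and ht: "ht (translate L n z) = n + ht z" for n z
    using L by (simp_all add: translate_def shift_def red_def ht_def)
  have tr_tr: "translate L n (translate L m z) = translate L (n + m) z" for n m and z :: "'q \<times> int \<times> bool"
    by (simp add: translate_def shift_def algebra_simps)
  let ?B = "B \<times> {0..<L} \<times> (UNIV :: bool set)"
  have red_id: "red b = b" and ht_0: "ht b = 0" if "b \<in> ?B" for b
    using that by (auto simp: red_def ht_def)
  have \<psi>_tr: "\<psi> x (translate L n z) = translate L n (\<psi> x z)" and \<psi>_B: "fst (\<psi> x z) \<in> B \<longleftrightarrow> fst z \<in> B"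
    if "x \<in> carrier G" for x n z
  proof -
    have *: "\<psi> x \<in> carrier (equivariant_perms (B \<times> UNIV) (range (translate L)))"
      using \<psi> that by (auto simp: hom_def)
    show "\<psi> x (translate L n z) = translate L n (\<psi> x z)"
      by (rule equivariant_permsD(2)[OF *]) simp
    have "\<psi> x z \<in> B \<times> UNIV \<longleftrightarrow> z \<in> B \<times> UNIV" by (rule equivariant_permsD(1)[OF *])
    then show "fst (\<psi> x z) \<in> B \<longleftrightarrow> fst z \<in> B" by (cases z; cases "\<psi> x z") simp
  qed
  have \<psi>_mult: "\<psi> (x \<otimes> y) z = \<psi> x (\<psi> y z)" if "x \<in> carrier G" "y \<in> carrier G" for x y z
    using hom_mult[OF \<psi> that] by simp
  have \<psi>_one: "\<psi> \<one> z = z" for z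
    using hom_one[OF \<psi> is_group group_equivariant_perms] by simp
  have \<psi>_split: "\<psi> (x \<otimes> y) b = translate L (ht (\<psi> y b)) (\<psi> x (red (\<psi> y b)))"
    if "x \<in> carrier G" "y \<in> carrier G" for x y b
    using \<psi>_mult[OF that] \<psi>_tr[OF that(1)] split[of "\<psi> y b"] by metis
  \<comment> \<open>The given point differs from its representative by a translation, which commutes
    with the action and can be cancelled.\<close>
  have red_z: "\<psi> (g [^] k) (red z) = translate L 1 (red z)"
  proof -
    have "translate L (ht z) (\<psi> (g [^] k) (red z)) = \<psi> (g [^] k) z"
      using \<psi>_tr[of "g [^] k"] split[of z] g by (metis nat_pow_closed)
    then have "translate L (ht z) (\<psi> (g [^] k) (red z)) = translate L (1 + ht z) (red z)"
      using gz split[of z] tr_tr by metis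
    then have "translate L (- ht z) (translate L (ht z) (\<psi> (g [^] k) (red z))) =
        translate L (- ht z) (translate L (1 + ht z) (red z))" by simp
    then show ?thesis unfolding tr_tr by (simp add: translate_def shift_def)
  qed
  have zB: "red z \<in> ?B" using z L by (auto simp: red_def)
  show ?thesis
  proof (rule virtual_retract_if_cocycle[where B = ?B and act = "\<lambda>x b. red (\<psi> x b)"
        and \<sigma> = "\<lambda>x b. ht (\<psi> x b)" and \<beta> = "red z" and k = k])
    show "red (\<psi> x b) \<in> ?B" if "x \<in> carrier G" "b \<in> ?B" for x b
      using \<psi>_B[OF that(1), of b] that(2) L by (auto simp: red_def)
  qed (use fin g k zB red_id ht_0 in \<open>simp_all add: \<psi>_one \<psi>_split red ht red_z\<close>)
qed

section \<open>The fundamental group\<close>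

definition word_val :: "('a, 'm) monoid_scheme \<Rightarrow> ('x \<Rightarrow> 'a) \<Rightarrow> 'x word \<Rightarrow> 'a" where
  "word_val H i u = foldr (\<lambda>(x, b) h. (if b then i x else inv\<^bsub>H\<^esub> i x) \<otimes>\<^bsub>H\<^esub> h) u \<one>\<^bsub>H\<^esub>"

text \<open>Von Dyck's theorem: evaluation of words respects free cancellation in any group and the
  relations by assumption, hence is constant on classes.\<close>

lemma presented_group_hom:
  assumes H: "group H" and i: "\<And>x. x \<in> S \<Longrightarrow> i x \<in> carrier H"
    and R: "\<And>u v. \<lbrakk>(u, v) \<in> R; u \<in> words S; v \<in> words S\<rbrakk> \<Longrightarrow> word_val H i u = word_val H i v"
  obtains \<psi> where "\<psi> \<in> hom (presented_group S R) H"
    and "\<And>u. u \<in> words S \<Longrightarrow> \<psi> (word_class S R u) = word_val H i u"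
proof -
  interpret H: group H by (rule H)
  have simps: "word_val H i [] = \<one>\<^bsub>H\<^esub>"
    "word_val H i ((x, b) # u) = (if b then i x else inv\<^bsub>H\<^esub> i x) \<otimes>\<^bsub>H\<^esub> word_val H i u" for x b u
    by (simp_all add: word_val_def)
  have closed: "word_val H i u \<in> carrier H" if "u \<in> words S" for u
    using that by (induction u) (auto simp: simps i)
  have append: "word_val H i (u @ v) = word_val H i u \<otimes>\<^bsub>H\<^esub> word_val H i v"
    if "u \<in> words S" "v \<in> words S" for u v
    using that
  proof (induction u rule: list.induct)
    case (Cons s u)
    obtain x b where s: "s = (x, b)" by (cases s)
    have "x \<in> S" "u \<in> words S" using Cons.prems(1) s by auto
    then show ?case
      using Cons closed[of u] closed[of v] i[of x] by (simp add: s simps H.m_assoc)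
  qed (simp add: simps closed)
  have eq: "word_val H i u = word_val H i v" if "word_eq S R u v" for u v
    using that
  proof (induction rule: word_eq.induct)
    case (cong u v u' v')
    then show ?case using word_eq_words append by metis
  next
    case (cancel x b)
    then show ?case using i[of x] by (simp add: simps)
  qed (auto simp: R)
  define \<psi> where "\<psi> X = word_val H i (SOME u. u \<in> words S \<and> word_class S R u = X)" for X
  have \<psi>: "\<psi> (word_class S R u) = word_val H i u" if "u \<in> words S" for u
  proof -
    let ?v = "SOME v. v \<in> words S \<and> word_class S R v = word_class S R u"
    have "?v \<in> words S \<and> word_class S R ?v = word_class S R u"
      by (rule someI_ex) (use that in blast)
    then have "word_eq S R u ?v" using word_eq.refl[of ?v S R] by (auto simp: word_class_def)
    then show ?thesis by (simp add: \<psi>_def eq)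
  qed
  have carr: "carrier (presented_group S R) = word_class S R ` words S"
    by (simp add: presented_group_def)
  have "\<psi> \<in> hom (presented_group S R) H"
  proof (rule homI)
    show "\<psi> X \<in> carrier H" if "X \<in> carrier (presented_group S R)" for X
      using that unfolding carr by (elim imageE) (simp only: \<psi> closed)
    fix X Y assume "X \<in> carrier (presented_group S R)" "Y \<in> carrier (presented_group S R)"
    then obtain u v where u: "u \<in> words S" and v: "v \<in> words S"
      and XY: "X = word_class S R u" "Y = word_class S R v"
      unfolding carr by (elim imageE) (rule that)
    have "u @ v \<in> words S" using u v by simp
    then show "\<psi> (X \<otimes>\<^bsub>presented_group S R\<^esub> Y) = \<psi> X \<otimes>\<^bsub>H\<^esub> \<psi> Y"
      unfolding XY word_class_mult[OF u v] by (simp only: \<psi>[OF u] \<psi>[OF v] \<psi> append[OF u v])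
  qed
  then show thesis using \<psi> that by blast
qed

section \<open>Vertex groups, edge groups and stable letters inside the fundamental group\<close>

locale fundamental_group_setup = finite_graph_of_groups \<G>
  for \<G> :: "('v, 'e, 'g, 'h) graph_of_groups" +
  fixes T :: "('v, 'e) pre_digraph" and P :: "'e set"
    and G :: "('v, 'e, 'g) generator word set monoid" (structure)
  assumes max_tree: "maximal_tree T (base \<G>) (inversion \<G>)"
    and orient: "orientation P (base \<G>) (inversion \<G>)"
    and G_def: "G = fundamental_group \<G> T P"
begin

abbreviation \<Gamma> where "\<Gamma> \<equiv> base \<G>"
abbreviation rv where "rv \<equiv> inversion \<G>"
abbreviation gens where "gens \<equiv> fg_generators \<G> P"
abbreviation rels where "rels \<equiv> fg_relations \<G> T P"
abbreviation cls where "cls \<equiv> word_class gens rels"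
abbreviation \<iota> where "\<iota> \<equiv> vertex_embedding \<G> T P"
abbreviation VS where "VS \<equiv> vertex_subgroup \<G> T P"
abbreviation ES where "ES \<equiv> edge_subgroup \<G> T P"

text \<open>Stable letters for all edges, with the reverse edge receiving the inverse, so that paths
  may run through edges against the orientation.\<close>

definition \<tau> :: "'e \<Rightarrow> ('v, 'e, 'g) generator word set" where
  "\<tau> e = (if e \<in> P then cls [(Stable_Letter e, True)] else cls [(Stable_Letter (rv e), False)])"

sublocale G: group G
  unfolding G_def fundamental_group_def by (rule group_presented_group)

lemma P_arcs: "P \<subseteq> arcs \<Gamma>"
  using orient by (auto simp: orientation_def)

lemma rv_in_P_iff: "e \<in> arcs \<Gamma> \<Longrightarrow> rv e \<in> P \<longleftrightarrow> e \<notin> P"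
  using orient unfolding orientation_def
  by (metis (no_types, lifting) UnE arev_arev disjoint_iff imageE imageI)

lemma carrier_G: "carrier G = cls ` words gens"
  by (simp add: G_def fundamental_group_def presented_group_def)

lemma one_G: "\<one> = cls []"
  by (simp add: G_def fundamental_group_def presented_group_def)

lemma cls_closed [intro]: "u \<in> words gens \<Longrightarrow> cls u \<in> carrier G"
  by (simp add: carrier_G)

lemma cls_mult: "\<lbrakk>u \<in> words gens; v \<in> words gens\<rbrakk> \<Longrightarrow> cls u \<otimes> cls v = cls (u @ v)"
  by (simp add: G_def fundamental_group_def word_class_mult del: in_lists_conv_set)

lemma cls_rel: "\<lbrakk>(u, v) \<in> rels; u \<in> words gens; v \<in> words gens\<rbrakk> \<Longrightarrow> cls u = cls v"
  by (intro word_class_eq word_eq.rel)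

lemma gens_vertex: "\<lbrakk>v \<in> verts \<Gamma>; g \<in> carrier (vgroup \<G> v)\<rbrakk> \<Longrightarrow> Vertex_Elem v g \<in> gens"
  by (auto simp: fg_generators_def)

lemma gens_edge: "e \<in> P \<Longrightarrow> Stable_Letter e \<in> gens"
  by (auto simp: fg_generators_def)

lemma cls_inverse:
  assumes "x \<in> gens"
  shows "cls [(x, False)] = inv (cls [(x, True)])"
proof (rule G.inv_equality[symmetric])
  have "cls [(x, False), (x, True)] = cls []"
    using word_eq.cancel[OF assms, of _ False] by (intro word_class_eq) simp
  then show "cls [(x, False)] \<otimes> cls [(x, True)] = \<one>"
    using assms by (simp add: cls_mult one_G)
qed (use assms in auto)

lemma \<iota>_hom:
  assumes v: "v \<in> verts \<Gamma>"
  shows "group_hom (vgroup \<G> v) G (\<iota> v)"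
proof -
  interpret V: group "vgroup \<G> v" using v by (rule vgroup)
  show ?thesis
  proof (unfold_locales, rule homI)
    show "\<iota> v x \<in> carrier G" if "x \<in> carrier (vgroup \<G> v)" for x
      using that v by (auto simp: vertex_embedding_def gens_vertex)
    fix x y assume xy: "x \<in> carrier (vgroup \<G> v)" "y \<in> carrier (vgroup \<G> v)"
    then have "cls [(Vertex_Elem v x, True), (Vertex_Elem v y, True)] =
        cls [(Vertex_Elem v (x \<otimes>\<^bsub>vgroup \<G> v\<^esub> y), True)]"
      using v by (intro cls_rel) (auto simp: fg_relations_def gens_vertex)
    then show "\<iota> v (x \<otimes>\<^bsub>vgroup \<G> v\<^esub> y) = \<iota> v x \<otimes> \<iota> v y"
      using xy v by (simp add: vertex_embedding_def cls_mult gens_vertex)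
  qed
qed

lemma VS_subgroup: "v \<in> verts \<Gamma> \<Longrightarrow> subgroup (VS v) G"
  unfolding vertex_subgroup_def using \<iota>_hom by (rule group_hom.img_is_subgroup)

lemma alpha_hom: "e \<in> arcs \<Gamma> \<Longrightarrow> alpha \<G> e \<in> hom (egroup \<G> e) (vgroup \<G> (tail \<Gamma> e))"
  using alpha_mon by (simp add: mon_def)

lemma ES_subgroup:
  assumes e: "e \<in> arcs \<Gamma>"
  shows "subgroup (ES e) G"
proof -
  let ?v = "tail \<Gamma> e"
  interpret V: group_hom "vgroup \<G> ?v" G "\<iota> ?v" using e by (intro \<iota>_hom) simp
  interpret E: group_hom "egroup \<G> e" "vgroup \<G> ?v" "alpha \<G> e"
    using e egroup alpha_hom by (auto simp: group_hom_def group_hom_axioms_def)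
  show ?thesis
    unfolding edge_subgroup_def by (intro V.subgroup_img_is_subgroup E.img_is_subgroup)
qed

lemma ES_subset_VS: "e \<in> arcs \<Gamma> \<Longrightarrow> ES e \<subseteq> VS (tail \<Gamma> e)"
  using alpha_hom by (auto simp: edge_subgroup_def vertex_subgroup_def hom_def)

lemma \<tau>_closed: "e \<in> arcs \<Gamma> \<Longrightarrow> \<tau> e \<in> carrier G"
  using rv_in_P_iff[of e] by (auto simp: \<tau>_def gens_edge)

lemma \<tau>_rv: "e \<in> arcs \<Gamma> \<Longrightarrow> \<tau> (rv e) = inv \<tau> e"
  using rv_in_P_iff[of e] cls_inverse[OF gens_edge]
  by (cases "e \<in> P") (simp_all add: \<tau>_def cls_closed gens_edge)

lemma \<tau>_tree:
  assumes f: "f \<in> arcs T"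
  shows "\<tau> f = \<one>"
proof -
  have T: "rv f \<in> arcs T" "f \<in> arcs \<Gamma>"
    using max_tree f by (auto simp: maximal_tree_def max_subgraph_def subgraph_def)
  have *: "\<tau> f = \<one>" if "f \<in> arcs T" "f \<in> P" for f
  proof -
    have "cls [(Stable_Letter f, True)] = cls []"
      using that by (intro cls_rel) (auto simp: fg_relations_def gens_edge)
    then show ?thesis using that by (simp add: \<tau>_def one_G)
  qed
  show ?thesis
  proof (cases "f \<in> P")
    case False
    then have "\<tau> (rv f) = \<one>" using T by (intro *) (simp_all add: rv_in_P_iff)
    then show ?thesis using T \<tau>_rv[of "rv f"] by simp
  qed (use * f in blast)
qed

text \<open>For an edge outside \<open>P\<close> this is the defining relation of the reverse edge,
  conjugated back.\<close>

lemma \<tau>_conj: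
  assumes e: "e \<in> arcs \<Gamma>" and a: "a \<in> carrier (egroup \<G> e)"
  shows "\<tau> e \<otimes> \<iota> (head \<Gamma> e) (alpha \<G> (rv e) a) \<otimes> inv \<tau> e = \<iota> (tail \<Gamma> e) (alpha \<G> e a)"
proof -
  have *: "\<tau> e \<otimes> \<iota> (head \<Gamma> e) (alpha \<G> (rv e) a) \<otimes> inv \<tau> e = \<iota> (tail \<Gamma> e) (alpha \<G> e a)"
    if eP: "e \<in> P" and a: "a \<in> carrier (egroup \<G> e)" for e
  proof -
    have e: "e \<in> arcs \<Gamma>" using eP P_arcs by blast
    have mem: "alpha \<G> e a \<in> carrier (vgroup \<G> (tail \<Gamma> e))"
      "alpha \<G> (rv e) a \<in> carrier (vgroup \<G> (head \<Gamma> e))"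
      using alpha_hom[of e] alpha_hom[of "rv e"] egroup_inversion[of e] e a by (auto simp: hom_def)
    have "cls [(Stable_Letter e, True), (Vertex_Elem (head \<Gamma> e) (omega \<G> e a), True),
        (Stable_Letter e, False)] = cls [(Vertex_Elem (tail \<Gamma> e) (alpha \<G> e a), True)]"
      using eP e a mem
      by (intro cls_rel) (auto simp: fg_relations_def gens_edge gens_vertex omega_def)
    then show ?thesis
      using eP e mem
      by (simp add: \<tau>_def vertex_embedding_def omega_def cls_mult gens_edge gens_vertex flip: cls_inverse)
  qed
  show ?thesis
  proof (cases "e \<in> P")
    case False
    let ?x = "\<iota> (head \<Gamma> e) (alpha \<G> (rv e) a)" and ?y = "\<iota> (tail \<Gamma> e) (alpha \<G> e a)"
    interpret V: group_hom "vgroup \<G> (tail \<Gamma> e)" G "\<iota> (tail \<Gamma> e)" using e by (intro \<iota>_hom) simp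
    have y: "?y \<in> carrier G" using alpha_hom[OF e] a by (intro V.hom_closed) (auto simp: hom_def)
    have "inv \<tau> e \<otimes> ?y \<otimes> \<tau> e = ?x"
      using *[of "rv e"] False e a by (simp add: rv_in_P_iff egroup_inversion \<tau>_rv \<tau>_closed)
    then have "\<tau> e \<otimes> ?x \<otimes> inv \<tau> e = \<tau> e \<otimes> (inv \<tau> e \<otimes> ?y \<otimes> \<tau> e) \<otimes> inv \<tau> e" by simp
    also have "\<dots> = ?y" using \<tau>_closed[OF e] y 
      by (simp add: G.m_assoc) (simp flip: G.m_assoc)
    finally show ?thesis .
  qed (use * a in blast)
qed

lemma ES_conj:
  assumes e: "e \<in> arcs \<Gamma>" and x: "x \<in> ES (rv e)"
  shows "\<tau> e \<otimes> x \<otimes> inv \<tau> e \<in> ES e"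
proof -
  obtain a where "a \<in> carrier (egroup \<G> e)" "x = \<iota> (head \<Gamma> e) (alpha \<G> (rv e) a)"
    using x e by (auto simp: edge_subgroup_def egroup_inversion)
  then show ?thesis using \<tau>_conj[OF e] by (auto simp: edge_subgroup_def)
qed

text \<open>Formal inverses of generators are absorbed by the two steps: a vertex group is closed
  under inverses, and the inverse of a stable letter is \<open>\<tau>\<close> of the reverse
  edge.\<close>

lemma G_induct [consumes 1, case_names one vertex edge]:
  assumes X: "X \<in> carrier G" and one: "Q \<one>"
    and vertex: "\<And>v x X. \<lbrakk>v \<in> verts \<Gamma>; x \<in> VS v; X \<in> carrier G; Q X\<rbrakk> \<Longrightarrow> Q (x \<otimes> X)"
    and edge: "\<And>e X. \<lbrakk>e \<in> arcs \<Gamma>; X \<in> carrier G; Q X\<rbrakk> \<Longrightarrow> Q (\<tau> e \<otimes> X)"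
  shows "Q X"
proof -
  obtain u where u: "u \<in> words gens" "X = cls u" using X by (auto simp: carrier_G)
  have "Q (cls u)" using u(1)
  proof (induction u rule: list.induct)
    case Nil
    then show ?case using one by (simp add: one_G)
  next
    case (Cons s u)
    obtain z b where s: "s = (z, b)" by (cases s)
    have z: "z \<in> gens" and u: "u \<in> words gens" using Cons.prems s by auto
    have split: "cls (s # u) = cls [s] \<otimes> cls u" using z u by (simp add: cls_mult s del: in_lists_conv_set)
    show ?case
    proof (cases z)
      case (Vertex_Elem v g)
      then have v: "v \<in> verts \<Gamma>" "g \<in> carrier (vgroup \<G> v)" using z by (auto simp: fg_generators_def)
      then have "\<iota> v g \<in> VS v" by (auto simp: vertex_subgroup_def)
      then have "cls [s] \<in> VS v"
        using VS_subgroup[OF v(1)] cls_inverse[OF z] s Vertex_Elem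
        by (cases b) (auto simp: vertex_embedding_def subgroup.m_inv_closed)
      then show ?thesis unfolding split using v u Cons.IH by (intro vertex) auto
    next
      case (Stable_Letter e)
      then have e: "e \<in> P" "e \<in> arcs \<Gamma>" using z P_arcs by (auto simp: fg_generators_def)
      then have "cls [s] = \<tau> (if b then e else rv e)"
        using s Stable_Letter by (auto simp: \<tau>_def rv_in_P_iff)
      then show ?thesis unfolding split using e u Cons.IH by (auto intro!: edge)
    qed
  qed
  then show ?thesis by (simp add: u)
qed

text \<open>The vertex groups have to be conjugated by \<open>w\<close> in order that the stable letters in the tree stay
  trivial.\<close>

lemma twisted_hom:
  assumes H: "group H" and \<mu>: "\<mu> \<in> hom G H"
    and s: "\<And>e. e \<in> P \<Longrightarrow> s e \<in> carrier H"
    and comm: "\<And>e x. \<lbrakk>e \<in> P; x \<in> ES e\<rbrakk> \<Longrightarrow> s e \<otimes>\<^bsub>H\<^esub> \<mu> x = \<mu> x \<otimes>\<^bsub>H\<^esub> s e"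
  obtains \<psi> w where "\<psi> \<in> hom G H" "\<And>v. v \<in> verts \<Gamma> \<Longrightarrow> w v \<in> carrier H"
    and "\<And>v x. \<lbrakk>v \<in> verts \<Gamma>; x \<in> VS v\<rbrakk> \<Longrightarrow> \<psi> x = w v \<otimes>\<^bsub>H\<^esub> \<mu> x \<otimes>\<^bsub>H\<^esub> inv\<^bsub>H\<^esub> w v"
    and "\<And>e. e \<in> P \<Longrightarrow>
      \<psi> (\<tau> e) = w (tail \<Gamma> e) \<otimes>\<^bsub>H\<^esub> (s e \<otimes>\<^bsub>H\<^esub> \<mu> (\<tau> e)) \<otimes>\<^bsub>H\<^esub> inv\<^bsub>H\<^esub> w (head \<Gamma> e)"
proof -
  interpret H: group H by (rule H)
  interpret \<mu>: group_hom G H \<mu> by unfold_locales (rule \<mu>)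
  have subT: "subgraph T \<Gamma>" and revT: "rv ` arcs T \<subseteq> arcs T" and treeT: "serre_tree T rv"
    using max_tree by (simp_all add: maximal_tree_def max_subgraph_def)
  have th: "tail T = tail \<Gamma>" "head T = head \<Gamma>" "arcs T \<subseteq> arcs \<Gamma>"
    using subT by (auto simp: subgraph_def compatible_def)
  have vT: "verts T = verts \<Gamma>"
    using bidirected_digraph connected_base max_tree by (rule maximal_tree_spanning)
  interpret T: serre_graph T rv using bidirected_digraph subT revT by (rule serre_graph_subgraph)
  \<comment> \<open>On a tree edge in \<open>P\<close>, where \<open>\<tau> e\<close> is trivial,
    the stable letter is sent to the identity exactly when \<open>w\<close> at the head is
    \<open>w\<close> at the tail times \<open>s e\<close>. So \<open>w\<close> has to be a potential
    for these labels.\<close>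
  define r where "r e = (if e \<in> P then s e else inv\<^bsub>H\<^esub> s (rv e))" for e
  have r: "r e \<in> carrier H" if "e \<in> arcs T" for e
    using that th s rv_in_P_iff by (auto simp: r_def)
  have r_rv: "r (rv e) = inv\<^bsub>H\<^esub> r e" if "e \<in> arcs T" for e
    using that th s rv_in_P_iff[of e] by (auto simp: r_def)
  obtain w where w: "\<And>v. v \<in> verts T \<Longrightarrow> w v \<in> carrier H"
    and wT: "\<And>e. e \<in> arcs T \<Longrightarrow> w (head T e) = w (tail T e) \<otimes>\<^bsub>H\<^esub> r e"
    using T.tree_potential[of H r, OF treeT H r r_rv] by blast
  note w = w[unfolded vT]
  define i where "i z = (case z of
      Vertex_Elem v g \<Rightarrow> w v \<otimes>\<^bsub>H\<^esub> \<mu> (\<iota> v g) \<otimes>\<^bsub>H\<^esub> inv\<^bsub>H\<^esub> w v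
    | Stable_Letter e \<Rightarrow> w (tail \<Gamma> e) \<otimes>\<^bsub>H\<^esub> (s e \<otimes>\<^bsub>H\<^esub> \<mu> (\<tau> e)) \<otimes>\<^bsub>H\<^esub> inv\<^bsub>H\<^esub> w (head \<Gamma> e))" for z
  have i_simps: "i (Vertex_Elem v g) = w v \<otimes>\<^bsub>H\<^esub> \<mu> (\<iota> v g) \<otimes>\<^bsub>H\<^esub> inv\<^bsub>H\<^esub> w v"
    "i (Stable_Letter e) = w (tail \<Gamma> e) \<otimes>\<^bsub>H\<^esub> (s e \<otimes>\<^bsub>H\<^esub> \<mu> (\<tau> e)) \<otimes>\<^bsub>H\<^esub> inv\<^bsub>H\<^esub> w (head \<Gamma> e)" for v g e
    by (simp_all add: i_def)
  have \<iota>: "\<iota> v g \<in> carrier G" if "v \<in> verts \<Gamma>" "g \<in> carrier (vgroup \<G> v)" for v g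
    using group_hom.hom_closed[OF \<iota>_hom] that .
  have ends: "tail \<Gamma> e \<in> verts \<Gamma>" "head \<Gamma> e \<in> verts \<Gamma>" "\<tau> e \<in> carrier G" if "e \<in> P" for e
    using that P_arcs \<tau>_closed by auto
  have cancel: "x \<otimes>\<^bsub>H\<^esub> (inv\<^bsub>H\<^esub> x \<otimes>\<^bsub>H\<^esub> y) = y" "inv\<^bsub>H\<^esub> x \<otimes>\<^bsub>H\<^esub> (x \<otimes>\<^bsub>H\<^esub> y) = y"
    if "x \<in> carrier H" "y \<in> carrier H" for x y
    using that by (simp_all flip: H.m_assoc)
  have closed: "i z \<in> carrier H" if "z \<in> gens" for z
    using that w s \<iota> ends by (auto simp: fg_generators_def i_simps)
  have rel: "word_val H i u = word_val H i v" if "(u, v) \<in> rels" for u v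
  proof -
    from that consider
      (mult) a x y where "a \<in> verts \<Gamma>" "x \<in> carrier (vgroup \<G> a)" "y \<in> carrier (vgroup \<G> a)"
        "u = [(Vertex_Elem a x, True), (Vertex_Elem a y, True)]"
        "v = [(Vertex_Elem a (x \<otimes>\<^bsub>vgroup \<G> a\<^esub> y), True)]"
    | (edge) e a where "e \<in> P" "a \<in> carrier (egroup \<G> e)"
        "u = [(Stable_Letter e, True), (Vertex_Elem (head \<Gamma> e) (omega \<G> e a), True), (Stable_Letter e, False)]"
        "v = [(Vertex_Elem (tail \<Gamma> e) (alpha \<G> e a), True)]"
    | (tree) f where "f \<in> arcs T" "f \<in> P" "u = [(Stable_Letter f, True)]" "v = []"
      by (auto simp: fg_relations_def)
    then show ?thesis
    proof cases
      case mult
      then have "\<iota> a (x \<otimes>\<^bsub>vgroup \<G> a\<^esub> y) = \<iota> a x \<otimes> \<iota> a y"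
        using group_hom.hom_mult[OF \<iota>_hom] by blast
      then show ?thesis
        using mult w \<iota> by (simp add: word_val_def i_simps H.m_assoc cancel)
    next
      case edge
      have e: "e \<in> arcs \<Gamma>" using edge P_arcs by blast
      let ?x = "\<iota> (head \<Gamma> e) (alpha \<G> (rv e) a)" and ?y = "\<iota> (tail \<Gamma> e) (alpha \<G> e a)"
      have mem: "alpha \<G> e a \<in> carrier (vgroup \<G> (tail \<Gamma> e))"
        "alpha \<G> (rv e) a \<in> carrier (vgroup \<G> (head \<Gamma> e))"
        using alpha_hom[of e] alpha_hom[of "rv e"] egroup_inversion[of e] e edge(2)
        by (auto simp: hom_def)
      have xy: "?x \<in> carrier G" "?y \<in> carrier G" using mem e by (simp_all add: \<iota>)
      have "?y \<in> ES e" using edge(2) by (auto simp: edge_subgroup_def)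
      then have c: "s e \<otimes>\<^bsub>H\<^esub> \<mu> ?y = \<mu> ?y \<otimes>\<^bsub>H\<^esub> s e" using comm edge by blast
      have y: "\<mu> ?y = \<mu> (\<tau> e) \<otimes>\<^bsub>H\<^esub> (\<mu> ?x \<otimes>\<^bsub>H\<^esub> inv\<^bsub>H\<^esub> \<mu> (\<tau> e))"
        using arg_cong[OF \<tau>_conj[OF e edge(2)], of \<mu>] xy \<tau>_closed[OF e] by (simp add: H.m_assoc)
      note in_H = w[OF ends(1)[OF edge(1)]] w[OF ends(2)[OF edge(1)]] s[OF edge(1)]
        \<mu>.hom_closed[OF ends(3)[OF edge(1)]] \<mu>.hom_closed[OF xy(1)] \<mu>.hom_closed[OF xy(2)]
      \<comment> \<open>The factors \<open>w\<close> at the head cancel, and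
        \<open>\<mu> (\<tau> e)\<close> conjugates \<open>\<mu> ?x\<close> to
        \<open>\<mu> ?y\<close>. What remains of the edge relation is that \<open>s e\<close>
        commutes with \<open>\<mu> ?y\<close>.\<close>
      have "word_val H i u = w (tail \<Gamma> e) \<otimes>\<^bsub>H\<^esub> (s e \<otimes>\<^bsub>H\<^esub> (\<mu> (\<tau> e) \<otimes>\<^bsub>H\<^esub> (\<mu> ?x \<otimes>\<^bsub>H\<^esub> inv\<^bsub>H\<^esub> \<mu> (\<tau> e)))
          \<otimes>\<^bsub>H\<^esub> inv\<^bsub>H\<^esub> s e \<otimes>\<^bsub>H\<^esub> inv\<^bsub>H\<^esub> w (tail \<Gamma> e))"
        using in_H by (simp add: edge word_val_def i_simps omega_def H.m_assoc H.inv_mult_group cancel)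
      also have "\<dots> = w (tail \<Gamma> e) \<otimes>\<^bsub>H\<^esub> (s e \<otimes>\<^bsub>H\<^esub> \<mu> ?y \<otimes>\<^bsub>H\<^esub> inv\<^bsub>H\<^esub> s e \<otimes>\<^bsub>H\<^esub> inv\<^bsub>H\<^esub> w (tail \<Gamma> e))"
        by (simp only: y)
      also have "\<dots> = word_val H i v"
        unfolding c using in_H by (simp add: edge word_val_def i_simps H.m_assoc cancel)
      finally show ?thesis .
    next
      case tree
      have "w (head \<Gamma> f) = w (tail \<Gamma> f) \<otimes>\<^bsub>H\<^esub> s f" using wT[OF tree(1)] tree(2) by (simp add: r_def th)
      then show ?thesis
        using tree w s ends[OF tree(2)] \<tau>_tree[OF tree(1)] H.r_inv[of "w (head \<Gamma> f)"]
        by (simp add: word_val_def i_simps)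
    qed
  qed
  obtain \<psi> where \<psi>: "\<psi> \<in> hom (presented_group gens rels) H"
    and \<psi>_val: "\<And>u. u \<in> words gens \<Longrightarrow> \<psi> (cls u) = word_val H i u"
    using presented_group_hom[of H gens i rels, OF H closed rel] by blast
  show thesis
  proof (rule that)
    show "\<psi> \<in> hom G H" using \<psi> by (simp add: G_def fundamental_group_def)
    show "w v \<in> carrier H" if "v \<in> verts \<Gamma>" for v using w[OF that] .
    show "\<psi> x = w v \<otimes>\<^bsub>H\<^esub> \<mu> x \<otimes>\<^bsub>H\<^esub> inv\<^bsub>H\<^esub> w v" if "v \<in> verts \<Gamma>" "x \<in> VS v" for v x
      using that w \<iota> gens_vertex
      by (auto simp: vertex_subgroup_def vertex_embedding_def[of \<G> T P] \<psi>_val word_val_def i_simps)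
    show "\<psi> (\<tau> e) = w (tail \<Gamma> e) \<otimes>\<^bsub>H\<^esub> (s e \<otimes>\<^bsub>H\<^esub> \<mu> (\<tau> e)) \<otimes>\<^bsub>H\<^esub> inv\<^bsub>H\<^esub> w (head \<Gamma> e)" if "e \<in> P" for e
    proof -
      have "\<psi> (\<tau> e) = word_val H i [(Stable_Letter e, True)]"
        using that by (simp add: \<tau>_def[of e] \<psi>_val gens_edge)
      then show ?thesis using that w s ends by (simp add: word_val_def i_simps)
    qed
  qed
qed

subsection \<open>Paths\<close>

text \<open>A path \<open>(x\<^sub>1, e\<^sub>1), \<dots>, (x\<^sub>n, e\<^sub>n)\<close> represents the element \<open>x\<^sub>1 \<tau>(e\<^sub>1) \<dots> x\<^sub>n \<tau>(e\<^sub>n)\<close>, where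
  \<open>x\<^sub>i\<close> is an element of the group of the initial vertex of \<open>e\<^sub>i\<close>.\<close>

fun gpath :: "'v \<Rightarrow> (('v, 'e, 'g) generator word set \<times> 'e) list \<Rightarrow> 'v \<Rightarrow> bool" where
  "gpath u [] v \<longleftrightarrow> u = v"
| "gpath u ((x, e) # xs) v \<longleftrightarrow> e \<in> arcs \<Gamma> \<and> tail \<Gamma> e = u \<and> x \<in> VS u \<and> gpath (head \<Gamma> e) xs v"

fun pval :: "(('v, 'e, 'g) generator word set \<times> 'e) list \<Rightarrow> ('v, 'e, 'g) generator word set" where
  "pval [] = \<one>"
| "pval ((x, e) # xs) = x \<otimes> \<tau> e \<otimes> pval xs"

definition Rep :: "'v \<Rightarrow> 'v \<Rightarrow> ('v, 'e, 'g) generator word set set" where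
  "Rep u v = {pval xs \<otimes> x | xs x. gpath u xs v \<and> x \<in> VS v}"

lemma RepI: "\<lbrakk>gpath u xs v; x \<in> VS v\<rbrakk> \<Longrightarrow> pval xs \<otimes> x \<in> Rep u v"
  by (auto simp: Rep_def)

lemma VS_closed: "\<lbrakk>v \<in> verts \<Gamma>; x \<in> VS v\<rbrakk> \<Longrightarrow> x \<in> carrier G"
  by (rule subgroup.mem_carrier[OF VS_subgroup])

lemma ES_closed: "\<lbrakk>e \<in> arcs \<Gamma>; x \<in> ES e\<rbrakk> \<Longrightarrow> x \<in> carrier G"
  by (rule subgroup.mem_carrier[OF ES_subgroup])

lemma pval_closed: "gpath u xs v \<Longrightarrow> pval xs \<in> carrier G"
  by (induction u xs v rule: gpath.induct) (auto simp: \<tau>_closed VS_closed[OF tail_in_verts])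

lemma gpath_append: "gpath u (xs @ ys) v \<longleftrightarrow> (\<exists>w. gpath u xs w \<and> gpath w ys v)"
  by (induction u xs v rule: gpath.induct) auto

lemma gpath_arc: "\<lbrakk>gpath u xs v; (y, e) \<in> set xs\<rbrakk> \<Longrightarrow> e \<in> arcs \<Gamma> \<and> y \<in> VS (tail \<Gamma> e)"
  by (induction u xs v rule: gpath.induct) auto

lemma pval_append:
  "\<lbrakk>gpath u xs v; gpath v ys w\<rbrakk> \<Longrightarrow> pval (xs @ ys) = pval xs \<otimes> pval ys"
  by (induction u xs v rule: gpath.induct)
    (auto simp: pval_closed G.m_assoc \<tau>_closed VS_closed[OF tail_in_verts])

text \<open>The factor \<open>z\<close> merges with the first vertex element, or with the trailing
  one if the path has no edges. That the length is kept is what makes the later cancellation of a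
  backtrack shorten the path.\<close>

lemma gpath_absorb:
  assumes "v \<in> verts \<Gamma>" "z \<in> VS u" "gpath u ys v" "x \<in> VS v"
  obtains ys' x' where "gpath u ys' v" "x' \<in> VS v" "length ys' = length ys"
    and "pval ys' \<otimes> x' = z \<otimes> (pval ys \<otimes> x)"
proof (cases ys)
  case Nil
  then show ?thesis
    using assms subgroup.m_closed[OF VS_subgroup[OF assms(1)]] VS_closed[OF assms(1)]
    by (intro that[of "[]" "z \<otimes> x"]) auto
next
  case (Cons s ys')
  obtain y e where s: "s = (y, e)" by (cases s)
  have e: "e \<in> arcs \<Gamma>" "tail \<Gamma> e = u" "y \<in> VS u" "gpath (head \<Gamma> e) ys' v"
    using assms(3) by (auto simp: Cons s)
  have u: "u \<in> verts \<Gamma>" using e by auto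
  have "z \<otimes> y \<in> VS u" using subgroup.m_closed[OF VS_subgroup[OF u] assms(2) e(3)] .
  then show ?thesis
    using e pval_closed[OF e(4)] VS_closed[OF u] VS_closed[OF assms(1)] assms \<tau>_closed[OF e(1)]
    by (intro that[of "(z \<otimes> y, e) # ys'" x]) (auto simp: Cons s G.m_assoc)
qed

lemma Rep_mult:
  assumes "w \<in> verts \<Gamma>" "X \<in> Rep u v" "Y \<in> Rep v w" "v \<in> verts \<Gamma>"
  shows "X \<otimes> Y \<in> Rep u w"
proof -
  obtain xs x ys y where X: "X = pval xs \<otimes> x" "gpath u xs v" "x \<in> VS v"
    and Y: "Y = pval ys \<otimes> y" "gpath v ys w" "y \<in> VS w"
    using assms by (auto simp: Rep_def)
  obtain ys' y' where y': "gpath v ys' w" "y' \<in> VS w" "pval ys' \<otimes> y' = x \<otimes> (pval ys \<otimes> y)"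
    using gpath_absorb[OF assms(1) X(3) Y(2,3)] .
  have "X \<otimes> Y = pval xs \<otimes> (pval ys' \<otimes> y')"
    unfolding y' X Y
    using pval_closed[OF X(2)] pval_closed[OF Y(2)] VS_closed[OF assms(4) X(3)] VS_closed[OF assms(1) Y(3)]
    by (simp add: G.m_assoc)
  also have "\<dots> = pval (xs @ ys') \<otimes> y'"
    using pval_append[OF X(2) y'(1)] pval_closed[OF X(2)] pval_closed[OF y'(1)] VS_closed[OF assms(1) y'(2)]
    by (simp add: G.m_assoc)
  finally show ?thesis using X(2) y'(1,2) RepI[of u "xs @ ys'" w y'] by (auto simp: gpath_append)
qed

lemma Rep_VS: "\<lbrakk>v \<in> verts \<Gamma>; x \<in> VS v\<rbrakk> \<Longrightarrow> x \<in> Rep v v"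
  using RepI[of v "[]" v x] by (simp add: VS_closed)

lemma Rep_\<tau>:
  assumes e: "e \<in> arcs \<Gamma>"
  shows "\<tau> e \<in> Rep (tail \<Gamma> e) (head \<Gamma> e)"
proof -
  have "\<one> \<in> VS (tail \<Gamma> e)" "\<one> \<in> VS (head \<Gamma> e)"
    using e by (auto intro!: subgroup.one_closed VS_subgroup)
  then show ?thesis
    using e \<tau>_closed[OF e] RepI[of "tail \<Gamma> e" "[(\<one>, e)]" "head \<Gamma> e" \<one>] by simp
qed

text \<open>A walk in the maximal tree, with trivial vertex elements, represents the identity
  because its stable letters are trivial.\<close>

lemma Rep_one:
  assumes "u \<in> verts \<Gamma>" "v \<in> verts \<Gamma>"
  shows "\<one> \<in> Rep u v"
proof -
  have subT: "subgraph T \<Gamma>" and revT: "rv ` arcs T \<subseteq> arcs T" and treeT: "serre_tree T rv"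
    using max_tree by (simp_all add: maximal_tree_def max_subgraph_def)
  have th: "tail T = tail \<Gamma>" "head T = head \<Gamma>" "arcs T \<subseteq> arcs \<Gamma>"
    using subT by (auto simp: subgraph_def compatible_def)
  have vT: "verts T = verts \<Gamma>"
    using bidirected_digraph connected_base max_tree by (rule maximal_tree_spanning)
  interpret T: serre_graph T rv using bidirected_digraph subT revT by (rule serre_graph_subgraph)
  obtain p where "T.awalk u p v"
    using T.connected_imp_awalk[of u v] treeT assms vT unfolding serre_tree_def by blast
  then show ?thesis
  proof (induction p arbitrary: u)
    case Nil
    then show ?case
      using Rep_VS[OF assms(2) subgroup.one_closed[OF VS_subgroup[OF assms(2)]]]
      by (simp add: T.awalk_Nil_iff)
  next
    case (Cons e p)
    then have e: "e \<in> arcs T" "u = tail \<Gamma> e" "\<one> \<in> Rep (head \<Gamma> e) v"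
      by (auto simp: T.awalk_Cons_iff th)
    then have "\<one> \<in> Rep u (head \<Gamma> e)" using Rep_\<tau>[of e] \<tau>_tree[OF e(1)] th by auto
    from Rep_mult[OF assms(2) this e(3)] show ?case using e th by auto
  qed
qed

text \<open>A generator that lives elsewhere in the graph is reached from \<open>u\<close> by
  inserting the identity, represented by a path between the two vertices.\<close>

lemma Rep_all:
  assumes u: "u \<in> verts \<Gamma>" and X: "X \<in> carrier G"
  shows "X \<in> Rep u u"
  using X
proof (induction X rule: G_induct)
  case one
  then show ?case using Rep_one[OF u u] .
next
  case (vertex v x X)
  have "\<one> \<otimes> X \<in> Rep v u"
    using Rep_mult[OF u Rep_one[OF vertex(1) u] vertex(4) u] .
  then have "x \<otimes> (\<one> \<otimes> X) \<in> Rep v u"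
    using Rep_mult[OF u Rep_VS[OF vertex(1,2)] _ vertex(1)] by blast
  then have "\<one> \<otimes> (x \<otimes> (\<one> \<otimes> X)) \<in> Rep u u"
    using Rep_mult[OF u Rep_one[OF u vertex(1)] _ vertex(1)] by blast
  then show ?case using vertex VS_closed by simp
next
  case (edge e X)
  have ends: "tail \<Gamma> e \<in> verts \<Gamma>" "head \<Gamma> e \<in> verts \<Gamma>" using edge(1) by auto
  have "\<one> \<otimes> X \<in> Rep (head \<Gamma> e) u"
    using Rep_mult[OF u Rep_one[OF ends(2) u] edge(3) u] .
  then have "\<tau> e \<otimes> (\<one> \<otimes> X) \<in> Rep (tail \<Gamma> e) u"
    using Rep_mult[OF u Rep_\<tau>[OF edge(1)] _ ends(2)] by blast
  then have "\<one> \<otimes> (\<tau> e \<otimes> (\<one> \<otimes> X)) \<in> Rep u u"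
    using Rep_mult[OF u Rep_one[OF u ends(1)] _ ends(1)] by blast
  then show ?case using edge \<tau>_closed by simp
qed

text \<open>A representing path of minimal length does it. At a backtrack,
  \<open>\<tau> e \<otimes> z \<otimes> inv \<tau> e\<close> lies in the vertex group at the tail of
  \<open>e\<close>, so it can be merged into the rest of the path, which saves two edges.\<close>

lemma Rep_irreducible:
  assumes u: "u \<in> verts \<Gamma>" and X: "X \<in> Rep u u"
  obtains xs x where "gpath u xs u" "x \<in> VS u" "X = pval xs \<otimes> x"
    and "successively (\<lambda>(_, e) (y, e'). e' = rv e \<longrightarrow> y \<notin> ES e') xs"
proof -
  define R where "R n \<longleftrightarrow> (\<exists>xs x. gpath u xs u \<and> x \<in> VS u \<and> X = pval xs \<otimes> x \<and> length xs = n)" for n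
  have "\<exists>n. R n" using X by (auto simp: R_def Rep_def)
  then obtain n where "R n" and min: "\<And>m. m < n \<Longrightarrow> \<not> R m"
    by (metis exists_least_iff)
  then obtain xs x where xs: "gpath u xs u" "x \<in> VS u" "X = pval xs \<otimes> x" "length xs = n"
    by (auto simp: R_def)
  have "successively (\<lambda>(_, e) (y, e'). e' = rv e \<longrightarrow> y \<notin> ES e') xs"
  proof (rule ccontr)
    assume "\<not> ?thesis"
    then obtain a s t b where "xs = a @ s # t # b"
      "\<not> (case s of (_, e) \<Rightarrow> \<lambda>(y, e'). e' = rv e \<longrightarrow> y \<notin> ES e') t"
      by (elim not_successively_decomp)
    moreover obtain y e z e' where "s = (y, e)" "t = (z, e')" by (metis surj_pair)
    ultimately have dec: "xs = a @ (y, e) # (z, rv e) # b" and z: "z \<in> ES (rv e)" by auto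
    let ?v = "tail \<Gamma> e"
    have e: "e \<in> arcs \<Gamma>" "y \<in> VS ?v" and a: "gpath u a ?v" and b: "gpath ?v b u"
      using xs(1) by (auto simp: dec gpath_append)
    have v: "?v \<in> verts \<Gamma>" using e by simp
    have "\<tau> e \<otimes> z \<otimes> inv \<tau> e \<in> VS ?v" using ES_conj[OF e(1) z] ES_subset_VS[OF e(1)] by blast
    then have yz: "y \<otimes> (\<tau> e \<otimes> z \<otimes> inv \<tau> e) \<in> VS ?v"
      using subgroup.m_closed[OF VS_subgroup[OF v] e(2)] by blast
    obtain b' x' where b': "gpath ?v b' u" "x' \<in> VS u" "length b' = length b"
      "pval b' \<otimes> x' = y \<otimes> (\<tau> e \<otimes> z \<otimes> inv \<tau> e) \<otimes> (pval b \<otimes> x)"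
      using gpath_absorb[OF u yz b xs(2)] .
    have closed: "pval a \<in> carrier G" "pval b \<in> carrier G" "pval b' \<in> carrier G" "x \<in> carrier G"
      "x' \<in> carrier G" "y \<in> carrier G" "z \<in> carrier G" "\<tau> e \<in> carrier G"
      using pval_closed[OF a] pval_closed[OF b] pval_closed[OF b'(1)] VS_closed[OF u xs(2)]
        VS_closed[OF u b'(2)] VS_closed[OF v e(2)] \<tau>_closed[OF e(1)] ES_closed[OF _ z] e(1) by simp_all
    have "gpath ?v ((y, e) # (z, rv e) # b) u" using xs(1) e a by (auto simp: dec gpath_append)
    from pval_append[OF a this]
    have "X = pval a \<otimes> (pval b' \<otimes> x')"
      unfolding b'(4) using closed e(1) by (simp add: xs(3) dec \<tau>_rv G.m_assoc)
    then have "X = pval (a @ b') \<otimes> x'"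
      using pval_append[OF a b'(1)] closed by (simp add: G.m_assoc)
    then have "R (length (a @ b'))"
      unfolding R_def using a b' by (intro exI[of _ "a @ b'"] exI[of _ x']) (auto simp: gpath_append)
    then show False using min[of "length (a @ b')"] xs(4) b'(3) by (simp add: dec)
  qed
  then show thesis using that xs by blast
qed

subsection \<open>Finite quotients\<close>

text \<open>The letters of the word in the free group on the cosets \<open>q E\<^sub>e\<close> that is the image of a path with
  prefix \<open>p\<close>. A pair \<open>(e, q E\<^sub>e)\<close> stands for the conjugate of the letter \<open>s\<^sub>e\<close> by \<open>q\<close>.\<close>

definition letter :: "('q, 'm) monoid_scheme \<Rightarrow> (('v, 'e, 'g) generator word set \<Rightarrow> 'q) \<Rightarrow>
    ('v, 'e, 'g) generator word set \<Rightarrow> 'e \<Rightarrow> ('e \<times> 'q set) \<times> bool" where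
  "letter Q f p e = (if e \<in> P then ((e, f p <#\<^bsub>Q\<^esub> (f ` ES e)), True)
    else ((rv e, f (p \<otimes> \<tau> e) <#\<^bsub>Q\<^esub> (f ` ES (rv e))), False))"

fun letters :: "('q, 'm) monoid_scheme \<Rightarrow> (('v, 'e, 'g) generator word set \<Rightarrow> 'q) \<Rightarrow>
    ('v, 'e, 'g) generator word set \<Rightarrow> (('v, 'e, 'g) generator word set \<times> 'e) list \<Rightarrow> ('e \<times> 'q set) word" where
  "letters Q f p [] = []"
| "letters Q f p ((x, e) # xs) = letter Q f (p \<otimes> x) e # letters Q f (p \<otimes> x \<otimes> \<tau> e) xs"

text \<open>Letters that cancel carry the same coset. For \<open>e\<close> in \<open>P\<close>,
  equality of cosets puts the image of \<open>\<tau> e \<otimes> x \<otimes> inv \<tau> e\<close>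
  into that of \<open>ES e\<close>, and conjugation moves this to \<open>ES (rv e)\<close>. For
  other \<open>e\<close>, the twist sends \<open>\<tau> e\<close> to its image followed by an
  inverse letter; hence \<open>letter\<close> uses the coset at \<open>p \<otimes> \<tau> e\<close>,
  and the comparison yields \<open>f x\<close> directly.\<close>

lemma letter_backtrack:
  assumes f: "group_hom G Q f" and p: "p \<in> carrier G" and x: "x \<in> carrier G"
    and e: "e \<in> arcs \<Gamma>" "e' \<in> arcs \<Gamma>"
    and eq: "letter Q f (p \<otimes> \<tau> e \<otimes> x) e' = flip (letter Q f p e)"
  shows "e' = rv e \<and> f x \<in> f ` ES e'"
proof -
  interpret f: group_hom G Q f by (rule f)
  have sub: "subgroup (f ` ES e) Q" if "e \<in> arcs \<Gamma>" for e
    using f.subgroup_img_is_subgroup[OF ES_subgroup[OF that]] .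
  have cl: "\<tau> e \<in> carrier G" "\<tau> e' \<in> carrier G" using e \<tau>_closed by auto
  show ?thesis
  proof (cases "e \<in> P")
    case True
    then have "e' \<notin> P" "rv e' = e"
      and coset: "f p <#\<^bsub>Q\<^esub> (f ` ES e) = f (p \<otimes> \<tau> e \<otimes> x \<otimes> \<tau> e') <#\<^bsub>Q\<^esub> (f ` ES e)"
      using eq by (auto simp: letter_def split: if_splits)
    then have e': "e' = rv e" by auto
    let ?b = "p \<otimes> \<tau> e \<otimes> x \<otimes> \<tau> e'"
    have b: "?b \<in> carrier G" using p x cl by simp
    have "inv\<^bsub>Q\<^esub> f p \<otimes>\<^bsub>Q\<^esub> f ?b \<in> f ` ES e"
      using coset f.H.l_coset_eq_iff[OF sub[OF e(1)], of "f p" "f ?b"] p b by simp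
    then have "f (inv p \<otimes> ?b) \<in> f ` ES e" using f.hom_mult[of "inv p" ?b] p b by simp
    moreover have "inv p \<otimes> (p \<otimes> \<tau> e \<otimes> x \<otimes> \<tau> e') = \<tau> e \<otimes> x \<otimes> inv \<tau> e"
      using p x cl(1) e by (simp add: e' \<tau>_rv G.m_assoc) (simp flip: G.m_assoc)
    ultimately have "f (\<tau> e \<otimes> x \<otimes> inv \<tau> e) \<in> f ` ES e"
by simp
    then obtain y where y: "y \<in> ES e" "f (\<tau> e \<otimes> x \<otimes> inv \<tau> e) = f y" by blast
    have yG: "y \<in> carrier G" using ES_closed[OF e(1) y(1)] .
    have "inv \<tau> e \<otimes> y \<otimes> \<tau> e \<in> ES (rv e)"
      using ES_conj[of "rv e" y] y e by (simp add: \<tau>_rv \<tau>_closed)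
    moreover have "f (inv \<tau> e \<otimes> y \<otimes> \<tau> e) = f x"
    proof -
      have "f (inv \<tau> e \<otimes> y \<otimes> \<tau> e) = f (inv \<tau> e) \<otimes>\<^bsub>Q\<^esub> f (\<tau> e \<otimes> x \<otimes> inv \<tau> e) \<otimes>\<^bsub>Q\<^esub> f (\<tau> e)"
        using yG cl x by (simp add: y(2))
      also have "\<dots> = f (inv \<tau> e \<otimes> (\<tau> e \<otimes> x \<otimes> inv \<tau> e) \<otimes> \<tau> e)" using cl x by simp
      also have "inv \<tau> e \<otimes> (\<tau> e \<otimes> x \<otimes> inv \<tau> e) \<otimes> \<tau> e = x"
        using cl(1) x by (simp add: G.m_assoc) (simp flip: G.m_assoc)
      finally show ?thesis .
    qed
    ultimately show ?thesis using e' by (metis imageI)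
  next
    case False
    then have e': "e' \<in> P" "e' = rv e"
      and coset: "f (p \<otimes> \<tau> e \<otimes> x) <#\<^bsub>Q\<^esub> (f ` ES e') = f (p \<otimes> \<tau> e) <#\<^bsub>Q\<^esub> (f ` ES e')"
      using eq by (auto simp: letter_def split: if_splits)
    let ?a = "p \<otimes> \<tau> e"
    have a: "?a \<in> carrier G" using p cl by simp
    have "inv\<^bsub>Q\<^esub> f ?a \<otimes>\<^bsub>Q\<^esub> f (?a \<otimes> x) \<in> f ` ES e'"
      using coset[symmetric] f.H.l_coset_eq_iff[OF sub[OF e(2)], of "f ?a" "f (?a \<otimes> x)"] a x by simp
    then have "f (inv ?a \<otimes> (?a \<otimes> x)) \<in> f ` ES e'"
      using f.hom_mult[of "inv ?a" "?a \<otimes> x"] f.hom_inv[OF a] a x by simp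
    moreover have "inv (p \<otimes> \<tau> e) \<otimes> (p \<otimes> \<tau> e \<otimes> x) = x"
      using a x by (simp flip: G.m_assoc[of "inv ?a" ?a x])
    ultimately have "f x \<in> f ` ES e'" by simp
    then show ?thesis using e' by simp
  qed
qed

lemma letters_reduced:
  assumes f: "group_hom G Q f"
    and "gpath u xs v" "u \<in> verts \<Gamma>" "p \<in> carrier G"
    and "successively (\<lambda>(_, e) (y, e'). e' = rv e \<longrightarrow> f y \<notin> f ` ES e') xs"
  shows "reduced (letters Q f p xs)"
  using assms(2-)
proof (induction xs arbitrary: u p)
  case (Cons s xs)
  obtain x e where s: "s = (x, e)" by (cases s)
  have e: "e \<in> arcs \<Gamma>" "x \<in> carrier G" "gpath (head \<Gamma> e) xs v"
    using Cons.prems VS_closed by (auto simp: s)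
  have tail: "reduced (letters Q f (p \<otimes> x \<otimes> \<tau> e) xs)"
    using Cons.prems e \<tau>_closed[OF e(1)] by (intro Cons.IH[of "head \<Gamma> e"]) (auto simp: s successively_Cons)
  show ?case
  proof (cases xs)
    case (Cons t ys)
    obtain y e' where t: "t = (y, e')" by (cases t)
    have e': "e' \<in> arcs \<Gamma>" "y \<in> carrier G" "e' = rv e \<longrightarrow> f y \<notin> f ` ES e'"
      using Cons.prems(4) e VS_closed[of "head \<Gamma> e"] by (auto simp: s Cons t)
    have px: "p \<otimes> x \<in> carrier G" using Cons.prems(3) e by simp
    have "letter Q f (p \<otimes> x \<otimes> \<tau> e \<otimes> y) e' \<noteq> flip (letter Q f (p \<otimes> x) e)"
      using letter_backtrack[OF f px e'(2) e(1) e'(1)] e'(3) by blast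
    then show ?thesis using tail by (simp add: s Cons t)
  qed (simp add: s)
qed simp

text \<open>\<open>Q\<close> permutes the fibres over its points by left multiplication, while s_e
  moves the points within each fibre. Following the path, the fibre coordinate records the prefix in
  \<open>Q\<close> and the coordinate in the two lines is acted on by the reduced word
  \<open>?W\<close>, hence can be made to translate.\<close>

lemma virtual_retract_if_finite_quotient:
  fixes f :: "('v, 'e, 'g) generator word set \<Rightarrow> 'q"
  assumes f: "group_hom G Q f" and fin: "finite (carrier Q)"
    and u: "u \<in> verts \<Gamma>" and xs: "gpath u xs u" "xs \<noteq> []" and x: "x \<in> VS u"
    and red: "successively (\<lambda>(_, e) (y, e'). e' = rv e \<longrightarrow> f y \<notin> f ` ES e') xs"
    and g: "g \<in> carrier G" and k: "k > 0"
    and gk: "g [^] (k::nat) = pval xs \<otimes> x" and fgk: "f (g [^] k) = \<one>\<^bsub>Q\<^esub>"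
  shows "virtual_retract G (generate G {g})"
proof -
  interpret f: group_hom G Q f by (rule f)
  let ?W = "letters Q f \<one> xs"
  have "?W \<noteq> []" using xs(2) by (cases xs) auto
  then obtain c y where c: "c \<noteq> []" "cyclically_reduced c" and cy: "foldr (turn c) ?W y = shift (int (length c)) y"
    using reduced_word_translates[of ?W] letters_reduced[OF f xs(1) u G.one_closed red] by metis
  let ?L = "int (length c)" and ?E = "\<lambda>e. f ` ES e"
  let ?H = "equivariant_perms (carrier Q \<times> UNIV) (range (translate ?L)) :: ('q \<times> int \<times> bool \<Rightarrow> _) monoid"
  interpret H: group ?H by (rule group_equivariant_perms)
  \<comment> \<open>Both \<open>m\<close> and \<open>s'\<close> fix the points off the carrier, so
    that they are permutations of the whole type.\<close>
  define m where "m a z = (if fst z \<in> carrier Q then (a \<otimes>\<^bsub>Q\<^esub> fst z, snd z) else z)"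
    for a and z :: "'q \<times> int \<times> bool"
  \<comment> \<open>The inverse matches the bookkeeping along the path: after the prefix
    \<open>p\<close> the point lies over the inverse of \<open>f p\<close>, so the letter read there
    belongs to the coset of \<open>f p\<close>. The flag \<open>b = False\<close> gives the inverse
    permutation.\<close>
  define s' where "s' b e z = (if fst z \<in> carrier Q
      then (fst z, turn c ((e, inv\<^bsub>Q\<^esub> fst z <#\<^bsub>Q\<^esub> ?E e), b) (snd z)) else z)"
    for b and e :: 'e and z :: "'q \<times> int \<times> bool"
  define s where "s = s' True"
  have m_mult: "m (a \<otimes>\<^bsub>Q\<^esub> b) z = m a (m b z)" if "a \<in> carrier Q" "b \<in> carrier Q" for a b z
    using that by (simp add: m_def f.H.m_assoc)
  have m_one: "m \<one>\<^bsub>Q\<^esub> z = z" for z by (simp add: m_def prod_eq_iff)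
  have m: "m a \<in> carrier ?H" if a: "a \<in> carrier Q" for a
  proof (rule equivariant_permsI[where \<rho> = "m (inv\<^bsub>Q\<^esub> a)"])
    show "m (inv\<^bsub>Q\<^esub> a) (m a z) = z" "m a (m (inv\<^bsub>Q\<^esub> a) z) = z" for z
      using a by (simp_all add: m_one flip: m_mult)
  qed (use a in \<open>auto simp: m_def translate_def\<close>)
  have s: "s e \<in> carrier ?H" for e
    unfolding s_def
  proof (rule equivariant_permsI[where \<rho> = "s' False e"])
    show "s' False e (s' True e z) = z" "s' True e (s' False e z) = z" for z
      using turn_flip[OF c(2), of "(_, True)"] turn_flip[OF c(2), of "(_, False)"]
      by (simp_all add: s'_def prod_eq_iff)
  qed (auto simp: s'_def translate_def turn_shift)
  have mf: "(\<lambda>X. m (f X)) \<in> hom G ?H" by (rule homI) (auto simp: m m_mult)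
  \<comment> \<open>Multiplication by \<open>f z\<close> changes the fibre, but not the coset that
    selects the letter: \<open>f z\<close> lies in the image of the edge group and is absorbed on
    the right after inversion.\<close>
  have comm: "s e \<otimes>\<^bsub>?H\<^esub> m (f z) = m (f z) \<otimes>\<^bsub>?H\<^esub> s e" if e: "e \<in> P" and z: "z \<in> ES e" for e z
  proof
    fix t :: "'q \<times> int \<times> bool"
    have eA: "e \<in> arcs \<Gamma>" using e P_arcs by blast
    have E: "subgroup (?E e) Q" using f.subgroup_img_is_subgroup[OF ES_subgroup[OF eA]] .
    have fz: "f z \<in> ?E e" "f z \<in> carrier Q" using z ES_closed[OF eA] by auto
    have "inv\<^bsub>Q\<^esub> (f z \<otimes>\<^bsub>Q\<^esub> q) <#\<^bsub>Q\<^esub> ?E e = inv\<^bsub>Q\<^esub> q <#\<^bsub>Q\<^esub> ?E e" if q: "q \<in> carrier Q" for q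
    proof -
      have "inv\<^bsub>Q\<^esub> (inv\<^bsub>Q\<^esub> (f z \<otimes>\<^bsub>Q\<^esub> q)) \<otimes>\<^bsub>Q\<^esub> inv\<^bsub>Q\<^esub> q = f z"
        using fz q by (simp add: f.H.m_assoc)
      then show ?thesis using f.H.l_coset_eq_iff[OF E] fz q by simp
    qed
    then show "(s e \<otimes>\<^bsub>?H\<^esub> m (f z)) t = (m (f z) \<otimes>\<^bsub>?H\<^esub> s e) t"
      using fz by (simp add: s_def s'_def m_def)
  qed
  obtain \<psi> w where \<psi>: "\<psi> \<in> hom G ?H" and w: "\<And>v. v \<in> verts \<Gamma> \<Longrightarrow> w v \<in> carrier ?H"
    and \<psi>_VS: "\<And>v x. \<lbrakk>v \<in> verts \<Gamma>; x \<in> VS v\<rbrakk> \<Longrightarrow> \<psi> x = w v \<otimes>\<^bsub>?H\<^esub> m (f x) \<otimes>\<^bsub>?H\<^esub> inv\<^bsub>?H\<^esub> w v"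
    and \<psi>_\<tau>: "\<And>e. e \<in> P \<Longrightarrow> \<psi> (\<tau> e) =
      w (tail \<Gamma> e) \<otimes>\<^bsub>?H\<^esub> (s e \<otimes>\<^bsub>?H\<^esub> m (f (\<tau> e))) \<otimes>\<^bsub>?H\<^esub> inv\<^bsub>?H\<^esub> w (head \<Gamma> e)"
    using twisted_hom[of ?H "\<lambda>X. m (f X)" s, OF H.is_group mf s comm] by metis
  have w_inv: "(inv\<^bsub>?H\<^esub> w v) (w v z) = z" if "v \<in> verts \<Gamma>" for v z
    using fun_cong[OF H.l_inv[OF w[OF that]], of z] by simp
  have vertex_step: "\<psi> x (w v z) = w v (m (f x) z)" if "v \<in> verts \<Gamma>" "x \<in> VS v" for v x z
    using that by (simp add: \<psi>_VS w_inv)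
  have \<psi>_mult: "\<psi> (X \<otimes> Y) z = \<psi> X (\<psi> Y z)" if "X \<in> carrier G" "Y \<in> carrier G" for X Y z
    using hom_mult[OF \<psi> that] by simp
  have \<psi>_one: "\<psi> \<one> z = z" for z
    using hom_one[OF \<psi> G.is_group H.is_group] by simp
  have pos_step: "\<psi> (\<tau> e) (w (head \<Gamma> e) (inv\<^bsub>Q\<^esub> f (p \<otimes> \<tau> e), z)) =
      w (tail \<Gamma> e) (inv\<^bsub>Q\<^esub> f p, turn c (letter Q f p e) z)"
    if e: "e \<in> P" and p: "p \<in> carrier G" for e p z
  proof -
    have eA: "e \<in> arcs \<Gamma>" using e P_arcs by blast
    have "f (\<tau> e) \<otimes>\<^bsub>Q\<^esub> inv\<^bsub>Q\<^esub> f (p \<otimes> \<tau> e) = inv\<^bsub>Q\<^esub> f p"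
      using p \<tau>_closed[OF eA] by (simp add: f.H.inv_mult_group flip: f.H.m_assoc)
    then show ?thesis
      using e p eA \<tau>_closed[OF eA]
      by (simp add: \<psi>_\<tau> w_inv m_def s_def s'_def letter_def del: f.hom_mult)
  qed
  have edge_step: "\<psi> (\<tau> e) (w (head \<Gamma> e) (inv\<^bsub>Q\<^esub> f (p \<otimes> \<tau> e), z)) =
      w (tail \<Gamma> e) (inv\<^bsub>Q\<^esub> f p, turn c (letter Q f p e) z)"
    if e: "e \<in> arcs \<Gamma>" and p: "p \<in> carrier G" for e p z
  proof (cases "e \<in> P")
    case False
    let ?q = "p \<otimes> \<tau> e" and ?l = "letter Q f p e"
    have q: "?q \<in> carrier G" "?q \<otimes> \<tau> (rv e) = p"
      using p \<tau>_closed[OF e] e by (simp_all add: \<tau>_rv G.m_assoc)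
    have l: "letter Q f ?q (rv e) = flip ?l" using False e by (simp add: letter_def rv_in_P_iff)
    \<comment> \<open>The reverse edge reads the flipped letter, so its step, applied to the turned
      point, undoes the turn; inverting it gives the step for \<open>e\<close>.\<close>
    have "\<psi> (\<tau> (rv e)) (w (tail \<Gamma> e) (inv\<^bsub>Q\<^esub> f p, turn c ?l z)) = w (head \<Gamma> e) (inv\<^bsub>Q\<^esub> f ?q, z)"
      using pos_step[of "rv e" ?q "turn c ?l z"] False e q(1)
      unfolding q(2) l turn_flip[OF c(2)] by (simp add: rv_in_P_iff)
    then have "\<psi> (\<tau> e) (w (head \<Gamma> e) (inv\<^bsub>Q\<^esub> f ?q, z)) =
        \<psi> (\<tau> e) (\<psi> (\<tau> (rv e)) (w (tail \<Gamma> e) (inv\<^bsub>Q\<^esub> f p, turn c ?l z)))" by simp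
    also have "\<dots> = w (tail \<Gamma> e) (inv\<^bsub>Q\<^esub> f p, turn c ?l z)"
      using \<tau>_closed[OF e] e by (simp add: \<tau>_rv \<psi>_one flip: \<psi>_mult)
    finally show ?thesis .
  qed (rule pos_step[OF _ p])
  \<comment> \<open>The prefix \<open>p\<close> is arbitrary for the induction; only the empty
    prefix is used in the end. The factors \<open>w\<close> at intermediate vertices cancel.\<close>
  have path: "\<psi> (pval xs) (w v (inv\<^bsub>Q\<^esub> f (p \<otimes> pval xs), z)) =
      w u (inv\<^bsub>Q\<^esub> f p, foldr (turn c) (letters Q f p xs) z)"
    if "gpath u xs v" "u \<in> verts \<Gamma>" "p \<in> carrier G" for u v xs p z
    using that
  proof (induction xs arbitrary: u p)
    case (Cons t xs)
    obtain x e where t: "t = (x, e)" by (cases t)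
    have e: "e \<in> arcs \<Gamma>" "tail \<Gamma> e = u" "x \<in> VS u" "gpath (head \<Gamma> e) xs v"
      using Cons.prems by (auto simp: t)
    have cl: "x \<in> carrier G" "\<tau> e \<in> carrier G" "pval xs \<in> carrier G"
      using e VS_closed \<tau>_closed pval_closed Cons.prems(2) by auto
    let ?p = "p \<otimes> x \<otimes> \<tau> e"
    have p: "?p \<in> carrier G" "p \<otimes> x \<in> carrier G" using Cons.prems(3) cl by auto
    have assoc: "p \<otimes> pval ((x, e) # xs) = ?p \<otimes> pval xs"
      using Cons.prems(3) cl by (simp add: G.m_assoc)
    have "\<psi> (pval (t # xs)) (w v (inv\<^bsub>Q\<^esub> f (p \<otimes> pval (t # xs)), z)) =
        \<psi> x (\<psi> (\<tau> e) (\<psi> (pval xs) (w v (inv\<^bsub>Q\<^esub> f (?p \<otimes> pval xs), z))))"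
      unfolding t assoc using cl by (simp add: \<psi>_mult)
    also have "\<dots> = \<psi> x (\<psi> (\<tau> e) (w (head \<Gamma> e) (inv\<^bsub>Q\<^esub> f ?p, foldr (turn c) (letters Q f ?p xs) z)))"
      using Cons.IH[OF e(4) _ p(1)] e(1) by simp
    also have "\<dots> = \<psi> x (w u (inv\<^bsub>Q\<^esub> f (p \<otimes> x), foldr (turn c) (letters Q f p (t # xs)) z))"
      using edge_step[OF e(1) p(2)] by (simp add: t e(2))
    also have "\<dots> = w u (m (f x) (inv\<^bsub>Q\<^esub> f (p \<otimes> x), foldr (turn c) (letters Q f p (t # xs)) z))"
      using vertex_step[OF Cons.prems(2) e(3)] by simp
    also have "f x \<otimes>\<^bsub>Q\<^esub> inv\<^bsub>Q\<^esub> f (p \<otimes> x) = inv\<^bsub>Q\<^esub> f p"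
      using Cons.prems(3) cl by (simp add: f.H.inv_mult_group flip: f.H.m_assoc)
    then have "m (f x) (inv\<^bsub>Q\<^esub> f (p \<otimes> x), y) = (inv\<^bsub>Q\<^esub> f p, y)" for y
      using p(2) by (simp add: m_def del: f.hom_mult)
    finally show ?case .
  qed (simp add: \<psi>_one)
  let ?z = "w u (\<one>\<^bsub>Q\<^esub>, y)"
  have cl: "pval xs \<in> carrier G" "x \<in> carrier G" using pval_closed[OF xs(1)] VS_closed[OF u x] .
  have "f (pval xs) \<otimes>\<^bsub>Q\<^esub> f x = \<one>\<^bsub>Q\<^esub>" using fgk cl by (simp add: gk)
  \<comment> \<open>Because \<open>g^k\<close> dies in \<open>Q\<close>, the trailing element
    \<open>x\<close> moves the fibre over the identity to the one where the path starts acting, and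
    the path leads back to the identity.\<close>
  then have fx: "f x = inv\<^bsub>Q\<^esub> f (\<one> \<otimes> pval xs)"
    using cl by (metis f.H.inv_equality f.H.inv_comm f.hom_closed G.l_one)
  note wu = equivariant_permsD[OF w[OF u]]
  have "\<psi> (g [^] k) ?z = \<psi> (pval xs) (w u (m (f x) (\<one>\<^bsub>Q\<^esub>, y)))"
    using cl by (simp add: gk \<psi>_mult vertex_step[OF u x])
  also have "m (f x) (\<one>\<^bsub>Q\<^esub>, y) = (inv\<^bsub>Q\<^esub> f (\<one> \<otimes> pval xs), y)"
    using cl fx by (simp add: m_def)
  also have "\<psi> (pval xs) (w u \<dots>) = w u (\<one>\<^bsub>Q\<^esub>, shift ?L y)"
    using path[OF xs(1) u G.one_closed] by (simp add: cy)
  also have "(\<one>\<^bsub>Q\<^esub>, shift ?L y) = translate ?L 1 (\<one>\<^bsub>Q\<^esub>, y)"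
    by (simp add: translate_def)
  also have "w u \<dots> = translate ?L 1 ?z" by (rule wu) simp
  finally have "\<psi> (g [^] k) ?z = translate ?L 1 ?z" .
  moreover have "fst ?z \<in> carrier Q" using wu(1)[of "(\<one>\<^bsub>Q\<^esub>, y)"] by (cases ?z) simp
  ultimately show ?thesis
    using G.virtual_retract_if_translation[OF fin _ \<psi> g k] c(1) by simp
qed

end

section \<open>Choice of the finite quotient of \<open>A\<close>\<close>

theorem theorem1p5:
  fixes \<G> :: "('v, 'e, 'g, 'h) graph_of_groups"
    and T :: "('v, 'e) pre_digraph"
    and P :: "'e set"
    and A :: "'a monoid"
    and \<phi> :: "('v, 'e, 'g) generator word set \<Rightarrow> 'a"
  assumes "finite_graph_of_groups \<G>"
    and "maximal_tree T (base \<G>) (inversion \<G>)"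
    and "orientation P (base \<G>) (inversion \<G>)"
    and "VRC A"
    and "\<phi> \<in> hom (fundamental_group \<G> T P) A"
    and "\<forall>v\<in>verts (base \<G>). inj_on \<phi> (vertex_subgroup \<G> T P v)"
    and "\<forall>e\<in>arcs (base \<G>). closedin (profinite_topology A) (\<phi> ` edge_subgroup \<G> T P e)"
  shows "VRC (fundamental_group \<G> T P)"
proof -
  define G where "G = fundamental_group \<G> T P"
  interpret fundamental_group_setup \<G> T P G
    using assms(1-3) by (simp add: fundamental_group_setup_def fundamental_group_setup_axioms_def G_def)
  have A: "group A" using assms(4) by (simp add: VRC_def)
  interpret \<phi>: group_hom G A \<phi>
    using assms(5) A by (simp add: group_hom_def group_hom_axioms_def G_def[symmetric] G.is_group)
  note inj = assms(6) and closed = assms(7)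
  obtain u where u: "u \<in> verts \<Gamma>" using connected_base by (auto simp: connected_conv)
  have "virtual_retract G (generate G {g})" if g: "g \<in> carrier G" for g
  proof (cases "inj_on \<phi> (generate G {g})")
    case True
    then show ?thesis
      using \<phi>.virtual_retract_pullback[OF g] assms(4) g by (simp add: VRC_def)
  next
    case False
    then obtain k :: nat where k: "k > 0" "\<phi> (g [^]\<^bsub>G\<^esub> k) = \<one>\<^bsub>A\<^esub>" "g [^]\<^bsub>G\<^esub> k \<noteq> \<one>\<^bsub>G\<^esub>"
      using \<phi>.exists_pow_in_kernel[OF g] by blast
    have "g [^]\<^bsub>G\<^esub> k \<in> Rep u u" using Rep_all[OF u] g by simp
    then obtain xs x where xs: "gpath u xs u" "x \<in> VS u" and gk: "g [^]\<^bsub>G\<^esub> k = pval xs \<otimes>\<^bsub>G\<^esub> x"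
      and irr: "successively (\<lambda>(_, e) (y, e'). e' = rv e \<longrightarrow> y \<notin> ES e') xs"
      using Rep_irreducible[OF u] by blast
    have "xs \<noteq> []"
    proof
      \<comment> \<open>Without edges, \<open>g^k\<close> would be an element of the vertex group at
        \<open>u\<close> in the kernel of \<open>\<phi>\<close>, hence trivial by injectivity
        there.\<close>
      assume "xs = []"
      then have "g [^]\<^bsub>G\<^esub> k = x" using gk VS_closed[OF u xs(2)] by simp
      then have "\<phi> x = \<phi> \<one>\<^bsub>G\<^esub>" using k(2) by simp
      then have "x = \<one>\<^bsub>G\<^esub>"
        using xs(2) subgroup.one_closed[OF VS_subgroup[OF u]] by (rule inj_onD[OF bspec[OF inj u]])
      then show False using k(3) \<open>g [^]\<^bsub>G\<^esub> k = x\<close> by simp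
    qed
    \<comment> \<open>The finitely many vertex elements on the path outside the group of the edge
      that follows them; keeping all of them outside in the quotient preserves
      irreducibility.\<close>
    define bad where "bad = {(y, e). (y, e) \<in> set xs \<and> y \<notin> ES e}"
    have fin: "finite bad" by (rule finite_subset[of _ "set xs"]) (auto simp: bad_def)
    have arc: "e \<in> arcs \<Gamma> \<and> y \<in> VS (tail \<Gamma> e)" if "(y, e) \<in> set xs" for y e
      using gpath_arc[OF xs(1) that] .
    have "\<exists>N. finite_index A N \<and> N \<lhd> A \<and> (\<forall>n\<in>N. n \<otimes>\<^bsub>A\<^esub> \<phi> (fst t) \<notin> \<phi> ` ES (snd t))"
      if t: "t \<in> bad" for t
    proof -
      obtain y e where ye: "t = (y, e)" "(y, e) \<in> set xs" "y \<notin> ES e" using t by (auto simp: bad_def)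
      have e: "e \<in> arcs \<Gamma>" "y \<in> VS (tail \<Gamma> e)" using arc[OF ye(2)] by auto
      have v: "tail \<Gamma> e \<in> verts \<Gamma>" using e by simp
      \<comment> \<open>Both \<open>y\<close> and the edge group lie in one vertex group, where
        \<open>\<phi>\<close> is injective; only then can closedness separate them.\<close>
      have "\<phi> y \<notin> \<phi> ` ES e"
        using inj_on_image_mem_iff[OF bspec[OF inj v] e(2) ES_subset_VS[OF e(1)]] ye(3) by simp
      moreover have "\<phi> y \<in> carrier A" using VS_closed[OF v e(2)] by simp
      moreover have "closedin (profinite_topology A) (\<phi> ` ES e)" using closed e(1) by blast
      ultimately show ?thesis
        using closedin_profinite_separated[OF A, of "\<phi> ` ES e" "\<phi> y"] ye(1) by (metis fst_conv snd_conv)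
    qed
    then obtain N where N: "\<And>t. t \<in> bad \<Longrightarrow> finite_index A (N t)" "\<And>t. t \<in> bad \<Longrightarrow> N t \<lhd> A"
      and N_sep: "\<And>t n. \<lbrakk>t \<in> bad; n \<in> N t\<rbrakk> \<Longrightarrow> n \<otimes>\<^bsub>A\<^esub> \<phi> (fst t) \<notin> \<phi> ` ES (snd t)"
      by metis
    define M where "M = carrier A \<inter> (\<Inter>t\<in>bad. N t)"
    have M: "finite_index A M" "M \<lhd> A"
      unfolding M_def using fin N \<phi>.H.finite_index_INT[of bad N] \<phi>.H.finite_index_normal_INT[of bad N]
      by blast+
    interpret M: normal M A by (rule M(2))
    let ?f = "\<lambda>X. M #>\<^bsub>A\<^esub> \<phi> X"
    have "?f \<in> hom G (A Mod M)"
      using hom_compose[OF \<phi>.homh M.r_coset_hom_Mod] by (simp add: comp_def)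
    then have f: "group_hom G (A Mod M) ?f"
      by (simp add: group_hom_def group_hom_axioms_def G.is_group M.factorgroup_is_group)
    \<comment> \<open>If the images of \<open>y\<close> and of some \<open>z\<close> in the edge
      group agreed modulo \<open>M\<close>, the quotient of \<open>\<phi> z\<close> by
      \<open>\<phi> y\<close> would lie in \<open>N (y, e)\<close> and move \<open>\<phi> y\<close>
      into the image of the edge group.\<close>
    have "?f y \<notin> ?f ` ES e" if "(y, e) \<in> set xs" "y \<notin> ES e" for y e
    proof
      assume "?f y \<in> ?f ` ES e"
      then obtain z where z: "z \<in> ES e" "M #>\<^bsub>A\<^esub> \<phi> z = M #>\<^bsub>A\<^esub> \<phi> y" by auto
      have e: "e \<in> arcs \<Gamma>" "y \<in> VS (tail \<Gamma> e)" using arc[OF that(1)] by auto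
      have cl: "\<phi> y \<in> carrier A" "\<phi> z \<in> carrier A"
        using VS_closed[OF _ e(2)] ES_closed[OF e(1) z(1)] e(1) by simp_all
      have "\<phi> z \<otimes>\<^bsub>A\<^esub> inv\<^bsub>A\<^esub> \<phi> y \<in> M"
        using z(2) cl \<phi>.H.r_coset_eq_iff[OF M.subgroup_axioms] by simp
      then have "\<phi> z \<otimes>\<^bsub>A\<^esub> inv\<^bsub>A\<^esub> \<phi> y \<in> N (y, e)" using that by (auto simp: M_def bad_def)
      then have "\<phi> z \<otimes>\<^bsub>A\<^esub> inv\<^bsub>A\<^esub> \<phi> y \<otimes>\<^bsub>A\<^esub> \<phi> y \<notin> \<phi> ` ES e"
        using N_sep[of "(y, e)"] that by (simp add: bad_def)
      then show False using cl z(1) by (simp add: \<phi>.H.m_assoc)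
    qed
    then have "successively (\<lambda>(_, e) (y, e'). e' = rv e \<longrightarrow> ?f y \<notin> ?f ` ES e') xs"
      using irr by (elim successively_mono) auto
    moreover have "finite (carrier (A Mod M))"
      using M(1) by (simp add: FactGroup_def finite_index_def)
    moreover have "?f (g [^]\<^bsub>G\<^esub> k) = \<one>\<^bsub>A Mod M\<^esub>"
      using k(2) M.subset by simp
    ultimately show ?thesis
      using virtual_retract_if_finite_quotient[OF f _ u xs(1) \<open>xs \<noteq> []\<close> xs(2) _ g k(1) gk] by blast
  qed
  then show ?thesis
    using G.is_group by (simp add: VRC_def G_def)
qed

end
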